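(* Let $m>0$, let $U:\mathbb{R}^d\to\mathbb{R}$ be $m$-convex, continuously differentiable and $L$-gradient Lipschitz, and let $\pi$ be the probability measure with Lebesgue density $e^{-U}/\int e^{-U}$. Let $\varepsilon>0$ and $\mu_0\in\mathcal{P}_2(\mathbb{R}^d)$. Let $\gamma_\varepsilon>0$ and $n_\varepsilon\in\mathbb{N}$ satisfy $$\gamma_\varepsilon\le\min\{m\varepsilon/(4Ld),L^{-1}\},\qquad n_\varepsilon\ge\lceil\ln(2W_2^2(\mu_0,\pi)/\varepsilon)\,\gamma_\varepsilon^{-1}m^{-1}\rceil .$$ Then $W_2^2(\mu_0R_{\gamma_\varepsilon}^{n_\varepsilon},\pi)\le\varepsilon$.
   Context: $\mathcal{P}_2(\mathbb{R}^d)$ is the set of Borel probability measures on $\mathbb{R}^d$ with finite second moment; $W_2$ is the Wasserstein distance of order 2 for the Euclidean norm. $U$ is $m$-convex if $U(tx+(1-t)y)\le tU(x)+(1-t)U(y)-t(1-t)(m/2)\|x-y\|^2$ for all $x,y\in\mathbb{R}^d$, $t\in[0,1]$. $L$-gradient Lipschitz means $\|\nabla U(x)-\nabla U(y)\|\le L\|x-y\|$ for all $x,y$. For $\gamma>0$, $R_\gamma$ is the Markov kernel of the Unadjusted Langevin Algorithm: $R_\gamma(x,A)=(4\pi\gamma)^{-d/2}\int_A\exp(-\|y-x+\gamma\nabla U(x)\|^2/(4\gamma))\,dy$ (in the normalizing factor $\pi$ is the number), i.e. $R_\gamma(x,\cdot)$ is the law of $x-\gamma\nabla U(x)+\sqrt{2\gamma}\,G$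 with $G$ standard Gaussian in $\mathbb{R}^d$. $\mu K(A)=\int K(x,A)\,d\mu(x)$, and $R_\gamma^k$ is the $k$-fold composition (identity for $k=0$). Convention: $\ln 0=-\infty$, so that the lower bound on $n_\varepsilon$ is vacuous if $\mu_0=\pi$. *)

theory Defs
  imports "HOL-Probability.Probability"
begin

definition gradient :: "('a::euclidean_space \<Rightarrow> real) \<Rightarrow> 'a \<Rightarrow> 'a" where
  "gradient U x = (THE D. GDERIV U x :> D)"

definition continuously_differentiable :: "('a::euclidean_space \<Rightarrow> real) \<Rightarrow> bool" where
  "continuously_differentiable U \<longleftrightarrow>
     (\<forall>x. U differentiable (at x)) \<and> continuous_on UNIV (gradient U)"

lemma gradient_eqI:
  assumes "GDERIV U x :> D"
  shows "gradient U x = D"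
  unfolding gradient_def
proof (rule the_equality)
  fix D' assume "GDERIV U x :> D'"
  then have "(\<lambda>h. h \<bullet> D') = (\<lambda>h. h \<bullet> D)"
    using assms has_derivative_unique unfolding gderiv_def by blast
  then show "D' = D"
    by (metis inner_commute vector_eq_ldot)
qed (fact assms)

lemma gderiv_gradient:
  assumes "U differentiable (at x)"
  shows "GDERIV U x :> gradient U x"
proof -
  obtain f' where f': "(U has_derivative f') (at x)"
    using assms unfolding differentiable_def by blast
  then have lin: "linear f'"
    using has_derivative_linear by blast
  have "f' h = h \<bullet> adjoint f' 1" for h
    using adjoint_works[OF lin, of h 1] by simp
  then have "f' = (\<lambda>h. h \<bullet> adjoint f' 1)"
    by blast
  then have "GDERIV U x :> adjoint f' 1"
    unfolding gderiv_def using f' by simp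
  then show ?thesis
    using gradient_eqI by metis
qed

definition strongly_convex :: "real \<Rightarrow> ('a::euclidean_space \<Rightarrow> real) \<Rightarrow> bool" where
  "strongly_convex m U \<longleftrightarrow>
     (\<forall>x y. \<forall>t\<in>{0..1}. U (t *\<^sub>R x + (1 - t) *\<^sub>R y)
        \<le> t * U x + (1 - t) * U y - t * (1 - t) * (m / 2) * (norm (x - y))\<^sup>2)"

definition P2 :: "'a::euclidean_space measure set" where
  "P2 = {\<mu>. sets \<mu> = sets borel \<and> prob_space \<mu> \<and>
             (\<integral>\<^sup>+x. ennreal ((norm x)\<^sup>2) \<partial>\<mu>) < \<infinity>}"

definition couplings ::
    "'a::euclidean_space measure \<Rightarrow> 'a measure \<Rightarrow> ('a \<times> 'a) measure set" where
  "couplings \<mu> \<nu> = {\<xi>. sets \<xi> = sets (borel \<Otimes>\<^sub>M borel) \<and>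
                       distr \<xi> borel fst = \<mu> \<and> distr \<xi> borel snd = \<nu>}"

definition esqrt :: "ennreal \<Rightarrow> ennreal" where
  "esqrt a = (if a = \<infinity> then \<infinity> else ennreal (sqrt (enn2real a)))"

lemma esqrt_power2: "(esqrt a)\<^sup>2 = a"
  by (cases a) (simp_all add: esqrt_def ennreal_power)

(* Kept in ennreal so that an infinite transport cost is not silently turned into 0. *)
definition W2 :: "'a::euclidean_space measure \<Rightarrow> 'a measure \<Rightarrow> ennreal" where
  "W2 \<mu> \<nu> = esqrt (INF \<xi>\<in>couplings \<mu> \<nu>. \<integral>\<^sup>+(x, y). ennreal ((norm (x - y))\<^sup>2) \<partial>\<xi>)"

definition gibbs :: "('a::euclidean_space \<Rightarrow> real) \<Rightarrow> 'a measure" where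
  "gibbs U = density lborel (\<lambda>x. ennreal (exp (- U x) / (\<integral>z. exp (- U z) \<partial>lborel)))"

definition ula_kernel ::
    "('a::euclidean_space \<Rightarrow> real) \<Rightarrow> real \<Rightarrow> 'a \<Rightarrow> 'a measure" where
  "ula_kernel U \<gamma> x = density lborel (\<lambda>y. ennreal
     ((4 * pi * \<gamma>) powr (- (real DIM('a) / 2)) *
      exp (- (norm (y - x + \<gamma> *\<^sub>R gradient U x))\<^sup>2 / (4 * \<gamma>))))"

(* For measurable K, emeasure (\<mu> \<bind> K) A is the integral of emeasure (K x) A over \<mu>
   (emeasure_bind), so bind is both the action on measures and the composition of kernels. *)
primrec kernel_power ::
    "('a::euclidean_space \<Rightarrow> 'a measure) \<Rightarrow> nat \<Rightarrow> 'a \<Rightarrow> 'a measure" where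
  "kernel_power K 0 = return borel"
| "kernel_power K (Suc k) = (\<lambda>x. kernel_power K k x \<bind> K)"

end

theory Submission
  imports Defs
begin

text \<open>
  Write \<open>\<pi>\<close> for \<open>gibbs U\<close>. One step of the algorithm is a gradient step followed by the heat flow for time
  \<open>\<gamma>\<close>, and it suffices to show
  \<open>W\<^sub>2\<^sup>2(\<mu>R, \<pi>) \<le> (1 - m\<gamma>) W\<^sub>2\<^sup>2(\<mu>, \<pi>) + 2\<gamma>\<^sup>2Ld\<close>.
  If \<open>(X, Y)\<close> couples \<open>\<mu>\<close> and \<open>\<pi>\<close> and \<open>X'\<close> is the gradient step from \<open>X\<close>, convexity gives
  \<open>|X' - Y|\<^sup>2 + 2\<gamma>(U X' - U Y) \<le> (1 - m\<gamma>)|X - Y|\<^sup>2\<close>.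
  During the heat flow one would run the stationary Langevin diffusion from \<open>Y\<close> with the same noise:
  the squared distance then grows at rate at most \<open>2(U X - U Y)\<close>, while the mean of \<open>U X\<close> grows at
  rate at most \<open>Ld\<close>. To avoid stochastic differential equations (and the entropy of the usual
  argument), the diffusion is replaced by the random walk Metropolis chain with step \<open>h = \<gamma>/N\<close>, which
  leaves \<open>\<pi>\<close> exactly invariant and whose mean displacement is \<open>-h\<nabla>U\<close> up to an error of order
  \<open>h\<^bsup>3/2\<^esup>\<close>. The accumulated error vanishes as \<open>N \<rightarrow> \<infinity>\<close>.
\<close>

section \<open>Gaussian measures\<close>

text \<open>The two halves of a step trade the quantity 2\<gamma>(E U X' - E U Y): the gradient step
  gains it, the heat flow spends it. It cancels, and besides the contracted distance only the growth
  of E U X along the flow remains. For this reason the gradient step keeps the value of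
  \<open>U\<close> at X', where the flow starts. Only real bounds are passed to the limit: for every
  N the chain yields a genuine coupling of the heat flow at time \<gamma> with \<pi>, so the squared
  distance lies below each of the costs. A discretised diffusion would have a biased law in the
  second coordinate; accepting or rejecting removes that bias. N errors of order h^(3/2) add up to
  order \<gamma> sqrt h if their constants are uniform. They involve only the second moment of X,
  which grows linearly in time, and the fourth moment of Y, which stays fixed. The one-step
  recursion has the fixed point 2\<gamma>Ld/m; the 4 in the step-size bound makes it at most
  \<epsilon>/2.\<close>

lemma has_bochner_integral_lborel_prod:
  fixes f :: "'a::euclidean_space \<Rightarrow> real \<Rightarrow> real"
  assumes "\<And>b. b \<in> Basis \<Longrightarrow> integrable lborel (f b)"
  shows "has_bochner_integral lborel (\<lambda>x. \<Prod>b\<in>Basis. f b (x \<bullet> b)) (\<Prod>b\<in>Basis. \<integral>x. f b x \<partial>lborel)"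
proof -
  interpret product_sigma_finite "\<lambda>_::'a. lborel :: real measure"
    by standard
  have [measurable]: "f b \<in> borel_measurable borel" if "b \<in> Basis" for b
    using assms[OF that] by simp
  have eq: "(\<Prod>b\<in>Basis. f b ((\<Sum>i\<in>Basis. x i *\<^sub>R i) \<bullet> b)) = (\<Prod>b\<in>Basis. f b (x b))" for x
    by (intro prod.cong) simp_all
  have "integrable lborel (\<lambda>x. \<Prod>b\<in>Basis. f b (x \<bullet> b))"
    by (subst lborel_eq, subst integrable_distr_eq) (simp_all add: eq product_integrable_prod assms)
  moreover have "(\<integral>x. (\<Prod>b\<in>Basis. f b (x \<bullet> b)) \<partial>lborel) = (\<Prod>b\<in>Basis. \<integral>x. f b x \<partial>lborel)"
    by (subst lborel_eq, subst integral_distr) (simp_all add: eq product_integral_prod assms)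
  ultimately show ?thesis
    by (simp add: has_bochner_integral_iff)
qed

text \<open>The heat kernel of the Laplacian at time \<open>s\<close>: each coordinate has variance
  2s. In this parametrisation times add under convolution, and the noise sqrt(2\<gamma>) G of the
  algorithm has law \<open>gauss \<gamma>\<close>.\<close>

definition gauss_density :: "real \<Rightarrow> 'a::euclidean_space \<Rightarrow> real" where
  "gauss_density s z = (4 * pi * s) powr (- (real DIM('a) / 2)) * exp (- (norm z)\<^sup>2 / (4 * s))"

definition gauss :: "real \<Rightarrow> 'a::euclidean_space measure" where
  "gauss s = density lborel (\<lambda>z. ennreal (gauss_density s z))"

lemma gauss_density_nonneg [simp]: "0 \<le> gauss_density s z"
  by (simp add: gauss_density_def)

lemma borel_measurable_gauss_density [measurable]: "gauss_density s \<in> borel_measurable borel"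
  unfolding gauss_density_def by measurable

lemma sets_gauss [measurable_cong, simp]: "sets (gauss s) = sets borel"
  by (simp add: gauss_def)

lemma space_gauss [simp]: "space (gauss s) = UNIV"
  by (simp add: gauss_def)

lemma gauss_density_prod:
  fixes z :: "'a::euclidean_space"
  assumes "s > 0"
  shows "gauss_density s z = (\<Prod>b\<in>Basis. normal_density 0 (sqrt (2 * s)) (z \<bullet> b))"
proof -
  have "(norm z)\<^sup>2 = (\<Sum>b\<in>Basis. (z \<bullet> b)\<^sup>2)"
    by (simp only: power2_norm_eq_inner) (simp only: euclidean_inner[of z z] power2_eq_square)
  then have "exp (- (norm z)\<^sup>2 / (4 * s)) = (\<Prod>b\<in>Basis. exp (- (z \<bullet> b)\<^sup>2 / (4 * s)))"
    by (simp add: exp_sum sum_divide_distrib flip: sum_negf)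
  moreover have "(4 * pi * s) powr (- (real DIM('a) / 2)) = (\<Prod>b\<in>(Basis::'a set). 1 / sqrt (4 * pi * s))"
  proof -
    have "1 / sqrt (4 * pi * s) = (4 * pi * s) powr (- (1 / 2))"
      using assms by (simp add: powr_minus_divide powr_half_sqrt del: powr_minus)
    then show ?thesis
      using assms by (simp add: powr_power)
  qed
  ultimately show ?thesis
    using assms by (simp add: gauss_density_def normal_density_def prod_dividef power_divide mult_ac)
qed

lemma has_bochner_integral_gauss_density:
  assumes "s > 0"
  shows "has_bochner_integral lborel (gauss_density s :: 'a::euclidean_space \<Rightarrow> real) 1"
  using has_bochner_integral_lborel_prod[of "\<lambda>_::'a. normal_density 0 (sqrt (2 * s))"] assms
  by (simp add: gauss_density_prod cong: has_bochner_integral_cong)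

lemma prob_space_gauss:
  assumes "s > 0"
  shows "prob_space (gauss s :: 'a::euclidean_space measure)"
proof
  have "(\<integral>\<^sup>+z. ennreal (gauss_density s z) \<partial>(lborel :: 'a measure)) = 1"
    using has_bochner_integral_gauss_density[OF assms, where 'a='a]
    by (simp add: nn_integral_eq_integral has_bochner_integral_iff)
  then show "emeasure (gauss s :: 'a measure) (space (gauss s)) = 1"
    by (simp add: gauss_def emeasure_density)
qed

lemma integral_gauss:
  fixes f :: "'a::euclidean_space \<Rightarrow> real"
  assumes "f \<in> borel_measurable borel"
  shows "(\<integral>z. f z \<partial>gauss s) = (\<integral>z. gauss_density s z * f z \<partial>lborel)"
    and "integrable (gauss s) f \<longleftrightarrow> integrable lborel (\<lambda>z. gauss_density s z * f z)"
  using assms by (simp_all add: gauss_def integral_density integrable_density)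

lemma gauss_covariance_Basis:
  fixes b c :: "'a::euclidean_space"
  assumes "s > 0" "b \<in> Basis" "c \<in> Basis"
  shows "has_bochner_integral (gauss s) (\<lambda>z. (z \<bullet> b) * (z \<bullet> c)) (2 * s * (b \<bullet> c))"
proof -
  define \<sigma> where "\<sigma> = sqrt (2 * s)"
  have \<sigma>: "\<sigma> > 0" "\<sigma>\<^sup>2 = 2 * s"
    using assms by (simp_all add: \<sigma>_def)
  \<comment> \<open>Both linear factors are pushed into the one-dimensional integrands, so that one
    product formula covers b = c (a second moment) and b \<noteq> c (two vanishing first
    moments).\<close>
  define f where "f i x = normal_density 0 \<sigma> x * ((if i = b then x else 1) * (if i = c then x else 1))"
    for i :: 'a and x
  have m1: "has_bochner_integral lborel (\<lambda>x. normal_density 0 \<sigma> x * x) 0"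
    using normal_moment_odd[OF \<sigma>(1), of 0 0] by simp
  have m2: "has_bochner_integral lborel (\<lambda>x. normal_density 0 \<sigma> x * (x * x)) (2 * s)"
    using normal_moment_even[OF \<sigma>(1), of 0 1] \<sigma>(2) by (simp add: power2_eq_square)
  have int: "integrable lborel (f i)" for i
    using m1 m2 \<sigma> unfolding f_def
    by (cases "i = b"; cases "i = c") (auto simp: has_bochner_integral_iff)
  have val: "(\<integral>x. f i x \<partial>lborel) = (if i = b \<and> i = c then 2 * s else if i = b \<or> i = c then 0 else 1)" for i
    using m1 m2 \<sigma> unfolding f_def
    by (cases "i = b"; cases "i = c") (auto simp: has_bochner_integral_iff)
  have "(\<Prod>i\<in>Basis. \<integral>x. f i x \<partial>lborel) = 2 * s * (b \<bullet> c)"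
  proof (cases "b = c")
    case True
    then have "(\<Prod>i\<in>Basis. \<integral>x. f i x \<partial>lborel) = (\<Prod>i\<in>Basis. if i = b then 2 * s else 1)"
      by (intro prod.cong) (auto simp: val)
    then show ?thesis
      using True assms by simp
  next
    case False
    then show ?thesis
      using assms by (auto simp: val inner_Basis intro!: prod_zero)
  qed
  moreover have "(\<Prod>i\<in>Basis. f i (z \<bullet> i)) = gauss_density s z * ((z \<bullet> b) * (z \<bullet> c))" for z
    using assms by (simp add: f_def prod.distrib gauss_density_prod \<sigma>_def)
  ultimately have "has_bochner_integral lborel (\<lambda>z. gauss_density s z * ((z \<bullet> b) * (z \<bullet> c))) (2 * s * (b \<bullet> c))"
    using has_bochner_integral_lborel_prod[of f, OF int] by simp
  then show ?thesis
    by (simp add: has_bochner_integral_iff integral_gauss)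
qed

lemma gauss_covariance:
  fixes v w :: "'a::euclidean_space"
  assumes "s > 0"
  shows "has_bochner_integral (gauss s) (\<lambda>z. (z \<bullet> v) * (z \<bullet> w)) (2 * s * (v \<bullet> w))"
proof -
  have "(z \<bullet> v) * (z \<bullet> w) = (\<Sum>b\<in>Basis. \<Sum>c\<in>Basis. ((v \<bullet> b) * (w \<bullet> c)) * ((z \<bullet> b) * (z \<bullet> c)))" for z
    by (simp add: euclidean_inner[of z v] euclidean_inner[of z w] sum_product algebra_simps)
  moreover have "(\<Sum>b\<in>Basis. \<Sum>c\<in>Basis. ((v \<bullet> b) * (w \<bullet> c)) * (2 * s * (b \<bullet> c))) = 2 * s * (v \<bullet> w)"
    by (simp add: inner_Basis if_distrib sum.delta euclidean_inner[of v w] sum_distrib_left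
        algebra_simps cong: if_cong sum.cong)
  moreover have "has_bochner_integral (gauss s)
      (\<lambda>z. \<Sum>b\<in>Basis. \<Sum>c\<in>Basis. ((v \<bullet> b) * (w \<bullet> c)) * ((z \<bullet> b) * (z \<bullet> c)))
      (\<Sum>b\<in>Basis. \<Sum>c\<in>Basis. ((v \<bullet> b) * (w \<bullet> c)) * (2 * s * (b \<bullet> c)))"
    by (intro has_bochner_integral_sum has_bochner_integral_mult_right gauss_covariance_Basis assms)
  ultimately show ?thesis
    by simp
qed

lemma gauss_norm_square:
  assumes "s > 0"
  shows "has_bochner_integral (gauss s :: 'a::euclidean_space measure) (\<lambda>z. (norm z)\<^sup>2) (2 * s * real DIM('a))"
proof -
  have "(norm z)\<^sup>2 = (\<Sum>b\<in>Basis. (z \<bullet> b) * (z \<bullet> b))" for z :: 'a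
    by (simp only: power2_norm_eq_inner) (simp only: euclidean_inner[of z z])
  moreover have "has_bochner_integral (gauss s) (\<lambda>z::'a. \<Sum>b\<in>Basis. (z \<bullet> b) * (z \<bullet> b)) (\<Sum>b\<in>(Basis::'a set). 2 * s * (b \<bullet> b))"
    by (intro has_bochner_integral_sum gauss_covariance assms)
  ultimately show ?thesis
    by (simp add: mult.commute)
qed

section \<open>Polynomial moments of Gaussians\<close>

lemma power_le_exp_square:
  fixes t c :: real
  assumes "t \<ge> 0" "c > 0"
  shows "t ^ k \<le> (1 + fact k / c ^ k) * exp (c * t\<^sup>2)"
proof -
  \<comment> \<open>A single term of the exponential series, written as a sum over a singleton. It
    controls the even power t^(2k); the power t^k itself is then reached through t^k \<le> 1 +
    t^(2k).\<close>
  have "(\<Sum>n\<in>{k}. (c * t\<^sup>2) ^ n /\<^sub>R fact n) \<le> exp (c * t\<^sup>2)"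
    unfolding exp_def using assms by (intro sum_le_suminf summable_exp_generic) auto
  then have "(c * t\<^sup>2) ^ k / fact k \<le> exp (c * t\<^sup>2)"
    by (simp add: divide_inverse mult.commute)
  then have "(t\<^sup>2) ^ k \<le> fact k / c ^ k * exp (c * t\<^sup>2)"
    using assms by (simp add: field_simps power_mult_distrib)
  moreover have "t ^ k \<le> 1 + (t ^ k)\<^sup>2"
  proof -
    have "0 \<le> (t ^ k - 1)\<^sup>2" "0 \<le> t ^ k"
      using assms by simp_all
    then show ?thesis
      by (simp add: power2_diff)
  qed
  moreover have "1 \<le> exp (c * t\<^sup>2)"
    using assms by simp
  ultimately show ?thesis
    unfolding distrib_right power2_eq_square power_mult_distrib by linarith
qed

text \<open>Half of the exponent absorbs the polynomial. The other half is, up to a constant,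
  \<open>gauss_density\<close> with parameter 1 / (2c), which is integrable.\<close>

lemma integrable_norm_power_exp_square:
  fixes c :: real
  assumes "c > 0"
  shows "integrable lborel (\<lambda>z::'a::euclidean_space. norm z ^ k * exp (- (c * (norm z)\<^sup>2)))"
proof (rule Bochner_Integration.integrable_bound)
  have "integrable lborel (\<lambda>z::'a. exp (- (c / 2 * (norm z)\<^sup>2)))"
    using has_bochner_integral_gauss_density[of "1 / (2 * c)", where 'a='a] assms
    by (simp add: has_bochner_integral_iff gauss_density_def[abs_def] mult_ac)
  then show "integrable lborel (\<lambda>z::'a. (1 + fact k / (c / 2) ^ k) * exp (- (c / 2 * (norm z)\<^sup>2)))"
    by (rule integrable_mult_right)
  show "AE z in lborel. norm (norm (z::'a) ^ k * exp (- (c * (norm z)\<^sup>2)))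
      \<le> norm ((1 + fact k / (c / 2) ^ k) * exp (- (c / 2 * (norm z)\<^sup>2)))"
  proof (rule AE_I2)
    fix z :: 'a
    have "norm z ^ k * exp (- (c * (norm z)\<^sup>2))
        \<le> (1 + fact k / (c / 2) ^ k) * exp (c / 2 * (norm z)\<^sup>2) * exp (- (c * (norm z)\<^sup>2))"
      using assms by (intro mult_right_mono power_le_exp_square) auto
    also have "\<dots> = (1 + fact k / (c / 2) ^ k) * exp (- (c / 2 * (norm z)\<^sup>2))"
      by (simp add: mult.assoc flip: exp_add)
    finally show "norm (norm z ^ k * exp (- (c * (norm z)\<^sup>2)))
        \<le> norm ((1 + fact k / (c / 2) ^ k) * exp (- (c / 2 * (norm z)\<^sup>2)))"
      using assms by (simp add: abs_mult)
  qed
qed measurable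

lemma integrable_gauss_norm_power:
  assumes "s > 0"
  shows "integrable (gauss s) (\<lambda>z::'a::euclidean_space. norm z ^ k)"
  using integrable_norm_power_exp_square[of "1 / (4 * s)" k, where 'a='a, THEN integrable_mult_right,
      of "(4 * pi * s) powr (- (real DIM('a) / 2))"] assms
  by (simp add: integral_gauss gauss_density_def mult_ac)

lemma integrable_gauss_bound:
  fixes f :: "'a::euclidean_space \<Rightarrow> real"
  assumes "s > 0" "f \<in> borel_measurable borel" "\<And>z. \<bar>f z\<bar> \<le> C * (1 + norm z ^ k)"
  shows "integrable (gauss s) f"
proof (rule Bochner_Integration.integrable_bound)
  interpret prob_space "gauss s :: 'a measure"
    using assms by (simp add: prob_space_gauss)
  show "integrable (gauss s) (\<lambda>z::'a. C * (1 + norm z ^ k))"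
    using assms by (simp add: integrable_gauss_norm_power)
  show "AE z in gauss s. norm (f z) \<le> norm (C * (1 + norm z ^ k))"
    using assms(3) by (auto intro!: AE_I2 order_trans[OF _ abs_ge_self])
qed (use assms in simp)

section \<open>Scaling, reflection and convolution of Gaussians\<close>

lemma gauss_density_scale:
  fixes z :: "'a::euclidean_space"
  assumes "s > 0"
  shows "gauss_density 1 z = sqrt s ^ DIM('a) * gauss_density s (sqrt s *\<^sub>R z)"
proof -
  have "s powr (- (real DIM('a) / 2)) * sqrt s ^ DIM('a) = 1"
    using assms by (simp add: powr_realpow[symmetric] powr_half_sqrt[symmetric] powr_powr powr_add[symmetric] del: powr_half_sqrt)
  then show ?thesis
    using assms by (simp add: gauss_density_def powr_mult power_mult_distrib mult_ac)
qed

lemma gauss_scale: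
  assumes "s > 0"
  shows "gauss s = distr (gauss 1) borel (\<lambda>z::'a::euclidean_space. sqrt s *\<^sub>R z)"
proof -
  have "gauss s = density (density (distr lborel borel (\<lambda>x::'a. 0 + sqrt s *\<^sub>R x)) (\<lambda>_. \<bar>sqrt s\<bar> ^ DIM('a)))
     (\<lambda>z. ennreal (gauss_density s z))"
    unfolding gauss_def using assms by (subst lborel_affine[of "sqrt s" 0]) simp_all
  also have "\<dots> = distr (density lborel (\<lambda>x::'a. ennreal (sqrt s ^ DIM('a) * gauss_density s (sqrt s *\<^sub>R x)))) borel (\<lambda>x. sqrt s *\<^sub>R x)"
    using assms by (subst density_density_eq, simp, simp, subst density_distr) 
      (simp_all add: ennreal_mult ennreal_power)
  also have "\<dots> = distr (gauss 1) borel (\<lambda>z::'a. sqrt s *\<^sub>R z)"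
    unfolding gauss_def using gauss_density_scale[OF assms, where 'a='a] by simp
  finally show ?thesis .
qed

text \<open>Isolates the dependence on the time: the moment of order k carries s^(k/2). Hence
  moments of order three and higher are O(h sqrt h) for small h, which is the error tolerated in one
  Metropolis step.\<close>

lemma integral_gauss_norm_power:
  assumes "s > 0"
  shows "(\<integral>z. norm (z::'a) ^ k \<partial>gauss s) = sqrt s ^ k * (\<integral>z. norm (z::'a::euclidean_space) ^ k \<partial>gauss 1)"
  using assms by (subst gauss_scale) (simp_all add: integral_distr power_mult_distrib)

lemma gauss_uminus: "distr (gauss s) borel uminus = (gauss s :: 'a::euclidean_space measure)"
proof -
  have "lborel = distr lborel borel (uminus :: 'a \<Rightarrow> 'a)"
    using lborel_affine[of "-1" "0::'a"] by (simp add: density_1)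
  then have "gauss s = density (distr lborel borel (uminus :: 'a \<Rightarrow> 'a)) (\<lambda>z. ennreal (gauss_density s z))"
    by (simp add: gauss_def)
  also have "\<dots> = distr (density lborel (\<lambda>z. ennreal (gauss_density s (- z)))) borel (uminus :: 'a \<Rightarrow> 'a)"
    by (subst density_distr) simp_all
  finally show ?thesis
    by (simp add: gauss_def gauss_density_def)
qed

text \<open>Reflection preserves \<open>gauss s\<close>, so the integral equals its own negative.
  For a non-integrable \<open>f\<close> the value 0 is the default of the Bochner integral.\<close>

lemma integral_gauss_odd:
  fixes f :: "'a::euclidean_space \<Rightarrow> real"
  assumes "f \<in> borel_measurable borel" "\<And>z. f (- z) = - f z"
  shows "(\<integral>z. f z \<partial>gauss s) = 0"
proof -
  have "(\<integral>z. f z \<partial>gauss s) = (\<integral>z. f z \<partial>distr (gauss s) borel uminus)"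
    by (simp add: gauss_uminus)
  also have "\<dots> = - (\<integral>z. f z \<partial>gauss s)"
    using assms by (subst integral_distr) simp_all
  finally show ?thesis
    by simp
qed

text \<open>Completing the square exhibits the convolution integrand as a Gaussian in the integration variable.\<close>

lemma gauss_density_convolution:
  fixes u :: "'a::euclidean_space"
  assumes "s > 0" "t > 0"
  shows "(\<integral>\<^sup>+z. ennreal (gauss_density s z * gauss_density t (u - z)) \<partial>lborel) = ennreal (gauss_density (s + t) u)"
proof -
  define r where "r = s * t / (s + t)"
  define p where "p = (s / (s + t)) *\<^sub>R u"
  have r: "r > 0"
    using assms by (simp add: r_def)
  have sq: "(norm z)\<^sup>2 / (4 * s) + (norm (u - z))\<^sup>2 / (4 * t) = (norm u)\<^sup>2 / (4 * (s + t)) + (norm (z - p))\<^sup>2 / (4 * r)" for z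
  proof -
    have "A / (4 * s) + (C - 2 * B + A) / (4 * t)
        = C / (4 * (s + t)) + (A - 2 * (s / (s + t)) * B + (s / (s + t))\<^sup>2 * C) / (4 * r)" for A B C
    proof -
      have "s + t \<noteq> 0"
        using assms by simp
      then show ?thesis
        using assms unfolding r_def by (simp add: divide_simps) algebra
    qed
    moreover have "(norm (u - z))\<^sup>2 = u \<bullet> u - 2 * (u \<bullet> z) + z \<bullet> z"
      "(norm (z - p))\<^sup>2 = z \<bullet> z - 2 * (s / (s + t)) * (u \<bullet> z) + (s / (s + t))\<^sup>2 * (u \<bullet> u)"
      unfolding p_def power2_norm_eq_inner
      by (simp_all add: inner_diff inner_commute power2_eq_square algebra_simps)
    ultimately show ?thesis
      by (simp only: power2_norm_eq_inner)
  qed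
  have c: "(4 * pi * s) powr e * (4 * pi * t) powr e = (4 * pi * (s + t)) powr e * (4 * pi * r) powr e" for e
  proof -
    have "(4 * pi * s) powr e * (4 * pi * t) powr e = ((4 * pi * s) * (4 * pi * t)) powr e"
      using assms by (subst powr_mult) simp_all
    also have "(4 * pi * s) * (4 * pi * t) = (4 * pi * (s + t)) * (4 * pi * r)"
      using assms by (simp add: r_def field_simps)
    also have "\<dots> powr e = (4 * pi * (s + t)) powr e * (4 * pi * r) powr e"
      using assms r by (subst powr_mult) simp_all
    finally show ?thesis .
  qed
  have "gauss_density s z * gauss_density t (u - z) = gauss_density (s + t) u * gauss_density r (z - p)" for z
  proof -
    have "exp (- (norm z)\<^sup>2 / (4 * s)) * exp (- (norm (u - z))\<^sup>2 / (4 * t))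
        = exp (- (norm u)\<^sup>2 / (4 * (s + t))) * exp (- (norm (z - p))\<^sup>2 / (4 * r))"
      using sq[of z] by (simp flip: exp_add)
    then have "((4 * pi * s) powr e * (4 * pi * t) powr e) * (exp (- (norm z)\<^sup>2 / (4 * s)) * exp (- (norm (u - z))\<^sup>2 / (4 * t)))
        = ((4 * pi * (s + t)) powr e * (4 * pi * r) powr e) * (exp (- (norm u)\<^sup>2 / (4 * (s + t))) * exp (- (norm (z - p))\<^sup>2 / (4 * r)))" for e
      by (simp only: c)
    from this[of "- (real DIM('a) / 2)"] show ?thesis
      unfolding gauss_density_def by (simp only: mult_ac)
  qed
  then have "(\<integral>\<^sup>+z. ennreal (gauss_density s z * gauss_density t (u - z)) \<partial>lborel)
      = (\<integral>\<^sup>+z. ennreal (gauss_density (s + t) u) * ennreal (gauss_density r (z - p)) \<partial>lborel)"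
    by (simp add: ennreal_mult)
  also have "\<dots> = ennreal (gauss_density (s + t) u) * (\<integral>\<^sup>+z. ennreal (gauss_density r (z - p)) \<partial>distr lborel borel ((+) p))"
    by (subst nn_integral_cmult) (simp_all add: lborel_distr_plus)
  also have "(\<integral>\<^sup>+z. ennreal (gauss_density r (z - p)) \<partial>distr lborel borel ((+) p)) = (\<integral>\<^sup>+z. ennreal (gauss_density r z) \<partial>(lborel :: 'a measure))"
    by (subst nn_integral_distr) simp_all
  also have "\<dots> = 1"
    using has_bochner_integral_gauss_density[OF r, where 'a='a]
    by (simp add: nn_integral_eq_integral has_bochner_integral_iff)
  finally show ?thesis
    by simp
qed

lemma nn_integral_gauss:
  fixes f :: "'a::euclidean_space \<Rightarrow> ennreal"
  assumes "f \<in> borel_measurable borel"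
  shows "(\<integral>\<^sup>+z. f z \<partial>gauss s) = (\<integral>\<^sup>+z. ennreal (gauss_density s z) * f z \<partial>lborel)"
  using assms by (simp add: gauss_def nn_integral_density)

lemma nn_integral_lborel_translate:
  fixes f :: "'a::euclidean_space \<Rightarrow> ennreal"
  assumes "f \<in> borel_measurable borel"
  shows "(\<integral>\<^sup>+z. f (a + z) \<partial>lborel) = (\<integral>\<^sup>+z. f z \<partial>lborel)"
proof -
  have "(\<integral>\<^sup>+z. f z \<partial>lborel) = (\<integral>\<^sup>+z. f z \<partial>distr lborel borel ((+) a))"
    by (simp add: lborel_distr_plus)
  also have "\<dots> = (\<integral>\<^sup>+z. f (a + z) \<partial>lborel)"
    using assms by (subst nn_integral_distr) simp_all
  finally show ?thesis ..
qed

text \<open>Tonelli moves the integration over the intermediate point inside, where it becomes the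
  convolution of the two densities. This is the semigroup law of the heat flow, tested against
  functions.\<close>

lemma nn_integral_gauss_gauss:
  fixes f :: "'a::euclidean_space \<Rightarrow> ennreal"
  assumes "s > 0" "t > 0" and [measurable]: "f \<in> borel_measurable borel"
  shows "(\<integral>\<^sup>+z. \<integral>\<^sup>+w. f (z + w) \<partial>gauss t \<partial>gauss s) = (\<integral>\<^sup>+u. f u \<partial>gauss (s + t))"
proof -
  have tr: "(\<integral>\<^sup>+w. ennreal (gauss_density t w) * f (z + w) \<partial>lborel) = (\<integral>\<^sup>+u. ennreal (gauss_density t (u - z)) * f u \<partial>lborel)" for z
    using nn_integral_lborel_translate[of "\<lambda>u. ennreal (gauss_density t (u - z)) * f u" z] by simp
  have "(\<integral>\<^sup>+z. \<integral>\<^sup>+w. f (z + w) \<partial>gauss t \<partial>gauss s)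
      = (\<integral>\<^sup>+z. ennreal (gauss_density s z) * (\<integral>\<^sup>+u. ennreal (gauss_density t (u - z)) * f u \<partial>lborel) \<partial>lborel)"
    by (simp add: nn_integral_gauss tr)
  also have "\<dots> = (\<integral>\<^sup>+z. \<integral>\<^sup>+u. ennreal (gauss_density s z * gauss_density t (u - z)) * f u \<partial>lborel \<partial>lborel)"
    by (intro nn_integral_cong) (simp add: nn_integral_cmult[symmetric] ennreal_mult mult.assoc)
  also have "\<dots> = (\<integral>\<^sup>+u. \<integral>\<^sup>+z. ennreal (gauss_density s z * gauss_density t (u - z)) * f u \<partial>lborel \<partial>lborel)"
    by (rule lborel_pair.Fubini') measurable
  also have "\<dots> = (\<integral>\<^sup>+u. ennreal (gauss_density (s + t) u) * f u \<partial>lborel)"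
    by (simp add: nn_integral_multc gauss_density_convolution assms)
  finally show ?thesis
    by (simp add: nn_integral_gauss)
qed

section \<open>Strongly convex potentials with Lipschitz gradient\<close>

locale smooth_convex_potential =
  fixes U :: "'a::euclidean_space \<Rightarrow> real" and m L :: real
  assumes m_pos: "m > 0"
    and convex: "strongly_convex m U"
    and C1: "continuously_differentiable U"
    and lipschitz: "L-lipschitz_on UNIV (gradient U)"
begin

lemma gderiv: "GDERIV U x :> gradient U x"
  using C1 by (simp add: continuously_differentiable_def gderiv_gradient)

lemma continuous_U: "continuous_on UNIV U"
  using gderiv by (meson continuous_at_imp_continuous_on gderiv_def has_derivative_continuous)

lemma measurable_U [measurable]: "U \<in> borel_measurable borel"
  by (rule borel_measurable_continuous_onI[OF continuous_U])

lemma measurable_gradient [measurable]: "gradient U \<in> borel_measurable borel"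
  using C1 by (intro borel_measurable_continuous_onI) (simp add: continuously_differentiable_def)

lemma gradient_lipschitz: "norm (gradient U x - gradient U y) \<le> L * norm (x - y)"
  using lipschitz by (simp add: lipschitz_on_def dist_norm)

lemma L_nonneg: "L \<ge> 0"
  using lipschitz by (simp add: lipschitz_on_def)

lemma DERIV_along_line:
  "((\<lambda>t. U (x + t *\<^sub>R v)) has_real_derivative gradient U (x + t *\<^sub>R v) \<bullet> v) (at t)"
proof -
  have "(U has_derivative (\<lambda>h. h \<bullet> gradient U (x + t *\<^sub>R v))) (at (x + t *\<^sub>R v))"
    using gderiv by (simp add: gderiv_def)
  moreover have "((\<lambda>t. x + t *\<^sub>R v) has_derivative (\<lambda>h. h *\<^sub>R v)) (at t)"
    by (auto intro!: derivative_eq_intros)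
  ultimately have "((\<lambda>t. U (x + t *\<^sub>R v)) has_derivative (\<lambda>h. (h *\<^sub>R v) \<bullet> gradient U (x + t *\<^sub>R v))) (at t)"
    by (rule has_derivative_compose[rotated])
  then show ?thesis
    by (simp add: has_field_derivative_def inner_commute mult.commute[of _ "_ \<bullet> _"])
qed

text \<open>Apply m-convexity to the point x + t(y - x), divide by t and let t decrease to 0: the
  difference quotient tends to the directional derivative and the factor 1 - t in the quadratic term
  tends to 1.\<close>

lemma lower_bound: "U x + gradient U x \<bullet> (y - x) + m / 2 * (norm (y - x))\<^sup>2 \<le> U y"
proof -
  define v where "v = y - x"
  have "((\<lambda>t. (U (x + t *\<^sub>R v) - U x) / t) \<longlongrightarrow> gradient U x \<bullet> v) (at_right 0)"
    using DERIV_along_line[of x v 0]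
    by (simp add: has_field_derivative_iff tendsto_within_subset[where S=UNIV])
  moreover have "((\<lambda>t. U y - U x - (1 - t) * (m / 2) * (norm v)\<^sup>2) \<longlongrightarrow> U y - U x - (1 - 0) * (m / 2) * (norm v)\<^sup>2) (at_right (0::real))"
    by (intro tendsto_intros)
  moreover have "\<forall>\<^sub>F t in at_right 0. (U (x + t *\<^sub>R v) - U x) / t \<le> U y - U x - (1 - t) * (m / 2) * (norm v)\<^sup>2"
  proof (rule eventually_at_rightI[of 0 1])
    fix t :: real
    assume t: "t \<in> {0<..<1}"
    then have "U (t *\<^sub>R y + (1 - t) *\<^sub>R x) \<le> t * U y + (1 - t) * U x - t * (1 - t) * (m / 2) * (norm (y - x))\<^sup>2"
      using convex by (simp add: strongly_convex_def)
    moreover have "t *\<^sub>R y + (1 - t) *\<^sub>R x = x + t *\<^sub>R v"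
      by (simp add: v_def algebra_simps)
    ultimately have "U (x + t *\<^sub>R v) - U x \<le> t * (U y - U x - (1 - t) * (m / 2) * (norm v)\<^sup>2)"
      by (simp add: v_def algebra_simps)
    then show "(U (x + t *\<^sub>R v) - U x) / t \<le> U y - U x - (1 - t) * (m / 2) * (norm v)\<^sup>2"
      using t by (simp add: divide_le_eq mult.commute)
  qed simp
  ultimately have "gradient U x \<bullet> v \<le> U y - U x - (1 - 0) * (m / 2) * (norm v)\<^sup>2"
    by (intro tendsto_le[OF trivial_limit_at_right_real])
  then show ?thesis
    by (simp add: v_def)
qed

lemma convex_lower_bound: "U x + gradient U x \<bullet> (y - x) \<le> U y"
  using lower_bound[of x y] m_pos by (smt (verit) mult_nonneg_nonneg zero_le_power2 divide_nonneg_nonneg)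

lemma upper_bound: "U y \<le> U x + gradient U x \<bullet> (y - x) + L / 2 * (norm (y - x))\<^sup>2"
proof -
  define v where "v = y - x"
  \<comment> \<open>Up to the constant \<open>U x\<close>, this is \<open>U\<close> on the segment
    minus its quadratic majorant. Its derivative is nonpositive by Cauchy-Schwarz and the Lipschitz
    bound, so comparing t = 1 with t = 0 gives the claim.\<close>
  define \<phi> where "\<phi> t = U (x + t *\<^sub>R v) - t * (gradient U x \<bullet> v) - L / 2 * (norm v)\<^sup>2 * t\<^sup>2" for t
  have "\<phi> 1 \<le> \<phi> 0"
  proof (rule DERIV_nonpos_imp_nonincreasing[of 0 1 \<phi>])
    fix t :: real
    assume t: "0 \<le> t" "t \<le> 1"
    have "(\<phi> has_real_derivative gradient U (x + t *\<^sub>R v) \<bullet> v - gradient U x \<bullet> v - L * (norm v)\<^sup>2 * t) (at t)"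
      unfolding \<phi>_def[abs_def] by (auto intro!: derivative_eq_intros DERIV_along_line)
    moreover have "gradient U (x + t *\<^sub>R v) \<bullet> v - gradient U x \<bullet> v - L * (norm v)\<^sup>2 * t \<le> 0"
    proof -
      have "(gradient U (x + t *\<^sub>R v) - gradient U x) \<bullet> v \<le> norm (gradient U (x + t *\<^sub>R v) - gradient U x) * norm v"
        by (rule norm_cauchy_schwarz)
      also have "\<dots> \<le> (L * norm (x + t *\<^sub>R v - x)) * norm v"
        by (intro mult_right_mono gradient_lipschitz) simp
      finally show ?thesis
        using t by (simp add: inner_diff_left power2_eq_square mult_ac)
    qed
    ultimately show "\<exists>y. (\<phi> has_real_derivative y) (at t) \<and> y \<le> 0"
      by blast
  qed simp
  then show ?thesis
    by (simp add: \<phi>_def v_def)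
qed

text \<open>Compare the two quadratic bounds along a unit vector. This forces L > 0, so that
  \<open>inverse L\<close> is a genuine bound on the step size, and together with \<gamma>L \<le> 1
  it makes the contraction factor nonnegative.\<close>

lemma m_le_L: "m \<le> L"
proof -
  obtain v :: 'a where v: "norm v = 1"
    using vector_choose_size[of 1] by auto
  have "m / 2 \<le> L / 2"
    using lower_bound[of 0 v] upper_bound[of v 0] v by simp
  then show ?thesis
    by simp
qed

lemma gradient_growth: "norm (gradient U x) \<le> norm (gradient U 0) + L * norm x"
  using gradient_lipschitz[of x 0] norm_triangle_sub[of "gradient U x" "gradient U 0"] by simp

text \<open>Quadratic growth makes \<open>U\<close> integrable against every measure in
  \<open>P2\<close>, so that all mean potentials below are meaningful real numbers.\<close>

lemma U_growth: "\<exists>C. \<forall>x. \<bar>U x\<bar> \<le> C * (1 + (norm x)\<^sup>2)"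
proof -
  define g where "g = norm (gradient U 0)"
  have "\<bar>U x\<bar> \<le> (\<bar>U 0\<bar> + g + L) * (1 + (norm x)\<^sup>2)" for x
  proof -
    have "\<bar>gradient U 0 \<bullet> x\<bar> \<le> g * norm x"
      by (simp add: g_def Cauchy_Schwarz_ineq2)
    moreover have "norm x \<le> 1 + (norm x)\<^sup>2"
      using zero_le_power2[of "norm x - 1"] by (simp add: power2_diff) (smt (verit) norm_ge_zero)
    then have "g * norm x \<le> g * (1 + (norm x)\<^sup>2)"
      by (intro mult_left_mono) (simp_all add: g_def)
    moreover have "0 \<le> L * (norm x)\<^sup>2" "0 \<le> \<bar>U 0\<bar> * (norm x)\<^sup>2"
      using L_nonneg by simp_all
    moreover have "U x \<le> U 0 + gradient U 0 \<bullet> x + L / 2 * (norm x)\<^sup>2" "U 0 + gradient U 0 \<bullet> x \<le> U x"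
      using upper_bound[of x 0] convex_lower_bound[of 0 x] by simp_all
    ultimately have "\<bar>U x\<bar> \<le> \<bar>U 0\<bar> + g * (1 + (norm x)\<^sup>2) + L * (norm x)\<^sup>2 + \<bar>U 0\<bar> * (norm x)\<^sup>2 + L"
      using L_nonneg by linarith
    then show ?thesis
      by (simp add: algebra_simps)
  qed
  then show ?thesis
    by blast
qed

text \<open>Descent along the gradient lowers \<open>U\<close> by at least \<gamma>/2 |g|^2 when
  \<gamma>L \<le> 1, and \<open>lower_bound\<close> at x compares \<open>U x\<close> with
  \<open>U y\<close>. Doubled and multiplied by \<gamma>, the descent gain is exactly the term
  \<gamma>^2 |g|^2 from expanding the square, and the terms with g \<bullet> (x - y) cancel as
  well.\<close>

lemma gradient_step:
  assumes "\<gamma> > 0" "\<gamma> * L \<le> 1"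
  shows "(norm (x - \<gamma> *\<^sub>R gradient U x - y))\<^sup>2 + 2 * \<gamma> * (U (x - \<gamma> *\<^sub>R gradient U x) - U y)
    \<le> (1 - m * \<gamma>) * (norm (x - y))\<^sup>2"
proof -
  define g where "g = gradient U x"
  have "U (x - \<gamma> *\<^sub>R g) \<le> U x - \<gamma> * (norm g)\<^sup>2 + L / 2 * \<gamma>\<^sup>2 * (norm g)\<^sup>2"
    using upper_bound[of "x - \<gamma> *\<^sub>R g" x] by (simp add: g_def power2_norm_eq_inner power_mult_distrib)
  moreover have "L / 2 * \<gamma>\<^sup>2 * (norm g)\<^sup>2 \<le> \<gamma> / 2 * (norm g)\<^sup>2"
    using assms mult_left_mono[of "\<gamma> * L" 1 \<gamma>]
    by (intro mult_right_mono) (simp_all add: power2_eq_square mult_ac)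
  ultimately have "U (x - \<gamma> *\<^sub>R g) \<le> U x - \<gamma> / 2 * (norm g)\<^sup>2"
    by linarith
  then have "U (x - \<gamma> *\<^sub>R g) - U y \<le> g \<bullet> (x - y) - m / 2 * (norm (x - y))\<^sup>2 - \<gamma> / 2 * (norm g)\<^sup>2"
    using lower_bound[of x y] by (simp add: g_def inner_diff_right norm_minus_commute)
  then have "2 * \<gamma> * (U (x - \<gamma> *\<^sub>R g) - U y)
      \<le> 2 * \<gamma> * (g \<bullet> (x - y) - m / 2 * (norm (x - y))\<^sup>2 - \<gamma> / 2 * (norm g)\<^sup>2)"
    using assms by (intro mult_left_mono) simp_all
  moreover have "(norm (x - \<gamma> *\<^sub>R g - y))\<^sup>2 = (norm (x - y))\<^sup>2 - 2 * \<gamma> * (g \<bullet> (x - y)) + \<gamma>\<^sup>2 * (norm g)\<^sup>2"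
    unfolding power2_norm_eq_inner by (simp add: inner_diff inner_commute power2_eq_square algebra_simps)
  ultimately show ?thesis
    by (simp add: g_def[symmetric] algebra_simps power2_eq_square)
qed

end

section \<open>The heat flow and the Gibbs measure\<close>

lemma P2D:
  assumes "\<mu> \<in> P2"
  shows "prob_space \<mu>" "sets \<mu> = sets borel" "space \<mu> = UNIV"
    "integrable \<mu> (\<lambda>x. (norm (x :: 'a::euclidean_space))\<^sup>2)"
proof -
  show p: "prob_space \<mu>" and s: "sets \<mu> = sets borel"
    using assms by (auto simp: P2_def)
  show "space \<mu> = UNIV"
    using sets_eq_imp_space_eq[OF s] by simp
  have "(\<lambda>x::'a. (norm x)\<^sup>2) \<in> borel_measurable \<mu>"
    using s by (simp cong: measurable_cong_sets)
  then show "integrable \<mu> (\<lambda>x. (norm (x :: 'a))\<^sup>2)"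
    using assms by (intro integrableI_nonneg) (auto simp: P2_def)
qed

lemma P2_integrable:
  fixes f :: "'a::euclidean_space \<Rightarrow> real"
  assumes \<mu>: "\<mu> \<in> P2" and f: "f \<in> borel_measurable borel" and b: "\<And>x. \<bar>f x\<bar> \<le> C * (1 + (norm x)\<^sup>2)"
  shows "integrable \<mu> f"
proof (rule Bochner_Integration.integrable_bound)
  interpret prob_space \<mu>
    using \<mu> by (rule P2D)
  show "integrable \<mu> (\<lambda>x. C * (1 + (norm x)\<^sup>2))"
    using P2D(4)[OF \<mu>] by simp
  show "f \<in> borel_measurable \<mu>"
    using f P2D(2)[OF \<mu>] by (simp cong: measurable_cong_sets)
  show "AE x in \<mu>. norm (f x) \<le> norm (C * (1 + (norm x)\<^sup>2))"
    using b by (auto intro!: AE_I2 order_trans[OF _ abs_ge_self])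
qed

lemma norm_add_square_le: "(norm (x + y :: 'a::real_normed_vector))\<^sup>2 \<le> 2 * (norm x)\<^sup>2 + 2 * (norm y)\<^sup>2"
proof -
  have "(norm (x + y))\<^sup>2 \<le> (norm x + norm y)\<^sup>2"
    by (intro power_mono norm_triangle_ineq) simp
  also have "\<dots> \<le> 2 * (norm x)\<^sup>2 + 2 * (norm y)\<^sup>2"
    using zero_le_power2[of "norm x - norm y"] unfolding power2_diff power2_sum by linarith
  finally show ?thesis .
qed

definition heat :: "real \<Rightarrow> 'a::euclidean_space measure \<Rightarrow> 'a measure" where
  "heat h \<nu> = distr (\<nu> \<Otimes>\<^sub>M gauss h) borel (\<lambda>(x, z). x + z)"

lemma sets_heat [measurable_cong, simp]: "sets (heat h \<nu>) = sets borel"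
  by (simp add: heat_def)

lemma space_heat [simp]: "space (heat h \<nu>) = UNIV"
  by (simp add: heat_def)

lemma measurable_add_pair:
  "sets \<nu> = sets borel \<Longrightarrow> (\<lambda>(x, z). x + z :: 'a::euclidean_space) \<in> borel_measurable (\<nu> \<Otimes>\<^sub>M gauss h)"
  by (simp cong: measurable_cong_sets)

lemma nn_integral_heat:
  fixes f :: "'a::euclidean_space \<Rightarrow> ennreal"
  assumes h: "h > 0" and [measurable_cong]: "sets \<nu> = sets borel" and [measurable]: "f \<in> borel_measurable borel"
  shows "(\<integral>\<^sup>+u. f u \<partial>heat h \<nu>) = (\<integral>\<^sup>+x. \<integral>\<^sup>+z. f (x + z) \<partial>gauss h \<partial>\<nu>)"
proof -
  interpret prob_space "gauss h :: 'a measure"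
    using h by (rule prob_space_gauss)
  show ?thesis
    unfolding heat_def by (subst nn_integral_distr) (simp_all add: nn_integral_fst[symmetric] split_beta')
qed

lemma prob_space_heat:
  fixes \<nu> :: "'a::euclidean_space measure"
  assumes h: "h > 0" and s: "sets \<nu> = sets borel" and "prob_space \<nu>"
  shows "prob_space (heat h \<nu>)"
proof -
  interpret N: prob_space "gauss h :: 'a measure"
    using h by (rule prob_space_gauss)
  interpret M: prob_space \<nu> by fact
  interpret pair_prob_space \<nu> "gauss h :: 'a measure" ..
  show ?thesis
    unfolding heat_def using s by (intro prob_space_distr measurable_add_pair)
qed

lemma heat_heat:
  fixes \<nu> :: "'a::euclidean_space measure"
  assumes "s > 0" "t > 0" and [measurable_cong]: "sets \<nu> = sets borel"
  shows "heat t (heat s \<nu>) = heat (s + t) \<nu>"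
proof (rule measure_eqI)
  fix A assume "A \<in> sets (heat t (heat s \<nu>))"
  then have [measurable]: "A \<in> sets borel"
    by simp
  interpret prob_space "gauss t :: 'a measure"
    using assms by (simp add: prob_space_gauss)
  have "(\<integral>\<^sup>+u. f u \<partial>heat t (heat s \<nu>)) = (\<integral>\<^sup>+u. f u \<partial>heat (s + t) \<nu>)"
    if [measurable]: "f \<in> borel_measurable borel" for f :: "'a \<Rightarrow> ennreal"
  proof -
    have "(\<integral>\<^sup>+u. f u \<partial>heat t (heat s \<nu>)) = (\<integral>\<^sup>+x. \<integral>\<^sup>+z. \<integral>\<^sup>+w. f (x + z + w) \<partial>gauss t \<partial>gauss s \<partial>\<nu>)"
      using assms by (simp add: nn_integral_heat)
    also have "\<dots> = (\<integral>\<^sup>+x. \<integral>\<^sup>+u. f (x + u) \<partial>gauss (s + t) \<partial>\<nu>)"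
      using nn_integral_gauss_gauss[OF assms(1,2), of "\<lambda>u. f (_ + u)"] by (simp add: add.assoc)
    also have "\<dots> = (\<integral>\<^sup>+u. f u \<partial>heat (s + t) \<nu>)"
      using assms by (simp add: nn_integral_heat)
    finally show ?thesis .
  qed
  from this[of "indicator A"] show "emeasure (heat t (heat s \<nu>)) A = emeasure (heat (s + t) \<nu>) A"
    by simp
qed simp

lemma heat_P2:
  fixes \<nu> :: "'a::euclidean_space measure"
  assumes h: "h > 0" and \<nu>: "\<nu> \<in> P2"
  shows "heat h \<nu> \<in> P2"
proof -
  note [measurable_cong] = P2D(2)[OF \<nu>]
  interpret N: prob_space "gauss h :: 'a measure"
    using h by (rule prob_space_gauss)
  interpret M: prob_space \<nu>
    using \<nu> by (rule P2D)
  have "(\<integral>\<^sup>+u. ennreal ((norm u)\<^sup>2) \<partial>heat h \<nu>) = (\<integral>\<^sup>+x. \<integral>\<^sup>+z. ennreal ((norm (x + z))\<^sup>2) \<partial>gauss h \<partial>\<nu>)"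
    using h by (simp add: nn_integral_heat P2D[OF \<nu>])
  also have "\<dots> \<le> (\<integral>\<^sup>+x. \<integral>\<^sup>+z. ennreal (2 * (norm x)\<^sup>2 + 2 * (norm (z::'a))\<^sup>2) \<partial>gauss h \<partial>\<nu>)"
    by (intro nn_integral_mono ennreal_leI norm_add_square_le)
  also have "\<dots> = (\<integral>\<^sup>+x. ennreal (2 * (norm x)\<^sup>2 + 4 * h * real DIM('a)) \<partial>\<nu>)"
  proof (intro nn_integral_cong)
    fix x :: 'a
    have "has_bochner_integral (gauss h) (\<lambda>z::'a. 2 * (norm x)\<^sup>2 + 2 * (norm z)\<^sup>2) (2 * (norm x)\<^sup>2 + 2 * (2 * h * real DIM('a)))"
      using gauss_norm_square[OF h, where 'a='a]
      by (intro has_bochner_integral_add has_bochner_integral_mult_right)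
        (auto simp: has_bochner_integral_iff N.prob_space[simplified])
    then show "(\<integral>\<^sup>+z. ennreal (2 * (norm x)\<^sup>2 + 2 * (norm (z::'a))\<^sup>2) \<partial>gauss h) = ennreal (2 * (norm x)\<^sup>2 + 4 * h * real DIM('a))"
      by (subst nn_integral_eq_integral) (auto simp: has_bochner_integral_iff mult.assoc)
  qed
  also have "\<dots> = ennreal (\<integral>x. 2 * (norm x)\<^sup>2 + 4 * h * real DIM('a) \<partial>\<nu>)"
    using P2D(4)[OF \<nu>] h by (intro nn_integral_eq_integral) auto
  also have "\<dots> < \<infinity>"
    by simp
  finally show ?thesis
    using h P2D[OF \<nu>] by (simp add: P2_def prob_space_heat)
qed

lemma integral_heat:
  fixes f :: "'a::euclidean_space \<Rightarrow> real"
  assumes h: "h > 0" and \<nu>: "\<nu> \<in> P2" and f[measurable]: "f \<in> borel_measurable borel"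
    and b: "\<And>x. \<bar>f x\<bar> \<le> C * (1 + (norm x)\<^sup>2)"
  shows "(\<integral>u. f u \<partial>heat h \<nu>) = (\<integral>x. \<integral>z. f (x + z) \<partial>gauss h \<partial>\<nu>)"
    and "integrable \<nu> (\<lambda>x. \<integral>z. f (x + z) \<partial>gauss h)"
proof -
  interpret N: prob_space "gauss h :: 'a measure"
    using h by (rule prob_space_gauss)
  interpret M: prob_space \<nu>
    using \<nu> by (rule P2D)
  interpret pair_prob_space \<nu> "gauss h :: 'a measure" ..
  have m: "(\<lambda>(x, z). x + z) \<in> borel_measurable (\<nu> \<Otimes>\<^sub>M gauss h)"
    using \<nu> by (intro measurable_add_pair P2D)
  have "integrable (heat h \<nu>) f"
    by (rule P2_integrable[OF heat_P2[OF h \<nu>] f b])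
  then have int: "integrable (\<nu> \<Otimes>\<^sub>M gauss h) (\<lambda>(x, z). f (x + z))"
    unfolding heat_def using integrable_distr_eq[OF m f] by (simp add: split_beta')
  show "integrable \<nu> (\<lambda>x. \<integral>z. f (x + z) \<partial>gauss h)"
    using integrable_fst'[OF int] by simp
  show "(\<integral>u. f u \<partial>heat h \<nu>) = (\<integral>x. \<integral>z. f (x + z) \<partial>gauss h \<partial>\<nu>)"
    unfolding heat_def using integral_distr[OF m f] integral_fst'[OF int] by (simp add: split_beta')
qed

lemma integral_gauss_inner [simp]: "(\<integral>z. v \<bullet> (z::'a::euclidean_space) \<partial>gauss h) = 0"
  by (intro integral_gauss_odd) simp_all

lemma integrable_gauss_inner:
  "h > 0 \<Longrightarrow> integrable (gauss h) (\<lambda>z::'a::euclidean_space. v \<bullet> z)"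
  by (rule integrable_gauss_bound[where C="norm v" and k=1])
    (auto intro!: order_trans[OF Cauchy_Schwarz_ineq2] mult_left_mono)

lemma integral_heat_norm_square:
  fixes \<nu> :: "'a::euclidean_space measure"
  assumes h: "h > 0" and \<nu>: "\<nu> \<in> P2"
  shows "(\<integral>u. (norm u)\<^sup>2 \<partial>heat h \<nu>) = (\<integral>x. (norm x)\<^sup>2 \<partial>\<nu>) + 2 * h * real DIM('a)"
proof -
  interpret N: prob_space "gauss h :: 'a measure"
    using h by (rule prob_space_gauss)
  interpret M: prob_space \<nu>
    using \<nu> by (rule P2D)
  have "(\<integral>z. (norm (x + z))\<^sup>2 \<partial>gauss h) = (norm x)\<^sup>2 + 2 * h * real DIM('a)" for x :: 'a
  proof -
    have "(\<integral>z. (norm (x + z))\<^sup>2 \<partial>gauss h) = (\<integral>z. (norm x)\<^sup>2 + 2 * (x \<bullet> z) + (norm z)\<^sup>2 \<partial>gauss h)"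
      by (simp add: power2_norm_eq_inner inner_add inner_commute algebra_simps)
    also have "\<dots> = (norm x)\<^sup>2 + 2 * h * real DIM('a)"
      using gauss_norm_square[OF h, where 'a='a] integrable_gauss_inner[OF h, of x] N.prob_space
      by (simp add: has_bochner_integral_iff)
    finally show ?thesis .
  qed
  moreover have "(\<integral>u. (norm u)\<^sup>2 \<partial>heat h \<nu>) = (\<integral>x. \<integral>z. (norm (x + z))\<^sup>2 \<partial>gauss h \<partial>\<nu>)"
    using h \<nu> by (intro integral_heat[where C=1]) auto
  ultimately show ?thesis
    using P2D(4)[OF \<nu>] M.prob_space by simp
qed

section \<open>Growth of the mean potential under the heat flow\<close>

context smooth_convex_potential
begin

lemma integrable_U:
  assumes "\<nu> \<in> P2"
  shows "integrable \<nu> U"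
proof -
  obtain C where "\<And>x. \<bar>U x\<bar> \<le> C * (1 + (norm x)\<^sup>2)"
    using U_growth by blast
  then show ?thesis
    by (rule P2_integrable[OF assms measurable_U])
qed

text \<open>In the quadratic upper bound around x the linear term averages to 0, and the quadratic
  term contributes L/2 times the mean square 2hd of the noise.\<close>

lemma integral_heat_U_le:
  assumes h: "h > 0" and \<nu>: "\<nu> \<in> P2"
  shows "(\<integral>u. U u \<partial>heat h \<nu>) \<le> (\<integral>x. U x \<partial>\<nu>) + L * h * real DIM('a)"
proof -
  interpret N: prob_space "gauss h :: 'a measure"
    using h by (rule prob_space_gauss)
  interpret M: prob_space \<nu>
    using \<nu> by (rule P2D)
  obtain C where C: "\<And>x. \<bar>U x\<bar> \<le> C * (1 + (norm x)\<^sup>2)"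
    using U_growth by blast
  note H = integral_heat[OF h \<nu> measurable_U C]
  have "(\<integral>z. U (x + z) \<partial>gauss h) \<le> U x + L * h * real DIM('a)" for x
  proof -
    have int: "integrable (gauss h) (\<lambda>z. U x + gradient U x \<bullet> z + L / 2 * (norm z)\<^sup>2)"
      using gauss_norm_square[OF h, where 'a='a] integrable_gauss_inner[OF h, of "gradient U x"]
      by (simp add: has_bochner_integral_iff)
    have "integrable (gauss h) (\<lambda>z. U (x + z))"
    proof (rule integrable_gauss_bound[OF h])
      fix z
      have "C \<ge> 0"
        using C[of 0] by simp
      have "\<bar>U (x + z)\<bar> \<le> C * (1 + (norm (x + z))\<^sup>2)"
        by (rule C)
      also have "\<dots> \<le> C * ((1 + 2 * (norm x)\<^sup>2 + 2) * (1 + norm z ^ 2))"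
      proof (rule mult_left_mono)
        have "0 \<le> (norm x)\<^sup>2 * (norm z)\<^sup>2"
          by simp
        then show "1 + (norm (x + z))\<^sup>2 \<le> (1 + 2 * (norm x)\<^sup>2 + 2) * (1 + norm z ^ 2)"
          using norm_add_square_le[of x z] zero_le_power2[of "norm z"]
          unfolding distrib_left distrib_right by linarith
      qed fact
      finally show "\<bar>U (x + z)\<bar> \<le> (C * (1 + 2 * (norm x)\<^sup>2 + 2)) * (1 + norm z ^ 2)"
        by (simp add: mult.assoc)
    qed measurable
    then have "(\<integral>z. U (x + z) \<partial>gauss h) \<le> (\<integral>z. U x + gradient U x \<bullet> z + L / 2 * (norm z)\<^sup>2 \<partial>gauss h)"
      using upper_bound[of "x + _" x] by (intro integral_mono int) simp_all
    also have "\<dots> = U x + L * h * real DIM('a)"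
      using gauss_norm_square[OF h, where 'a='a] integrable_gauss_inner[OF h, of "gradient U x"] N.prob_space
      by (simp add: has_bochner_integral_iff)
    finally show ?thesis .
  qed
  then have "(\<integral>x. \<integral>z. U (x + z) \<partial>gauss h \<partial>\<nu>) \<le> (\<integral>x. U x + L * h * real DIM('a) \<partial>\<nu>)"
    using H(2) integrable_U[OF \<nu>] by (intro integral_mono) simp_all
  also have "\<dots> = (\<integral>x. U x \<partial>\<nu>) + L * h * real DIM('a)"
    using integrable_U[OF \<nu>] M.prob_space by simp
  finally show ?thesis
    by (simp add: H(1))
qed

section \<open>Normalisation and moments of the Gibbs measure\<close>

lemma integrable_norm_power_exp_U: "integrable lborel (\<lambda>x::'a. norm x ^ k * exp (- U x))"
proof (rule Bochner_Integration.integrable_bound)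
  define g where "g = norm (gradient U 0)"
  show "integrable lborel (\<lambda>x::'a. exp (g\<^sup>2 / m - U 0) * (norm x ^ k * exp (- (m / 4 * (norm x)\<^sup>2))))"
    using m_pos by (intro integrable_mult_right integrable_norm_power_exp_square) simp
  show "AE x::'a in lborel. norm (norm x ^ k * exp (- U x)) \<le> norm (exp (g\<^sup>2 / m - U 0) * (norm x ^ k * exp (- (m / 4 * (norm x)\<^sup>2))))"
  proof (rule AE_I2)
    fix x :: 'a
    have "- (gradient U 0 \<bullet> x) \<le> g * norm x"
      using Cauchy_Schwarz_ineq2[of "gradient U 0" x] by (simp add: g_def)
    \<comment> \<open>Young's inequality, weighted so that the linear term costs only half of the
      quadratic coefficient m/2 of \<open>lower_bound\<close>. A Gaussian factor with exponent m/4
      is left over.\<close>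
    moreover have "g * norm x \<le> g\<^sup>2 / m + m / 4 * (norm x)\<^sup>2"
    proof -
      have "0 \<le> (g - m / 2 * norm x)\<^sup>2 / m"
        using m_pos by simp
      also have "\<dots> = g\<^sup>2 / m + m / 4 * (norm x)\<^sup>2 - g * norm x"
        using m_pos by (simp add: power2_eq_square field_simps)
      finally show ?thesis by simp
    qed
    ultimately have "- U x \<le> (g\<^sup>2 / m - U 0) + - (m / 4 * (norm x)\<^sup>2)"
      using lower_bound[of 0 x] by simp
    then have "exp (- U x) \<le> exp (g\<^sup>2 / m - U 0) * exp (- (m / 4 * (norm x)\<^sup>2))"
      by (simp flip: exp_add)
    then have "norm x ^ k * exp (- U x) \<le> norm x ^ k * (exp (g\<^sup>2 / m - U 0) * exp (- (m / 4 * (norm x)\<^sup>2)))"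
      by (intro mult_left_mono) simp_all
    then show "norm (norm x ^ k * exp (- U x)) \<le> norm (exp (g\<^sup>2 / m - U 0) * (norm x ^ k * exp (- (m / 4 * (norm x)\<^sup>2))))"
      by (simp add: abs_mult mult_ac)
  qed
qed measurable

definition Z :: real where "Z = (\<integral>z. exp (- U z) \<partial>lborel)"

lemma Z_pos: "Z > 0"
proof -
  have int: "integrable lborel (\<lambda>z. exp (- U z))"
    using integrable_norm_power_exp_U[of 0] by simp
  have "Z \<noteq> 0"
  proof
    assume "Z = 0"
    then have "AE z in lborel. exp (- U z) = 0"
      using integral_nonneg_eq_0_iff_AE[OF int] by (simp add: Z_def)
    then have "AE z in (lborel :: 'a measure). False"
      by simp
    then have "emeasure lborel (UNIV :: 'a set) = 0"
      by (simp add: eventually_False ae_filter_eq_bot_iff)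
    then show False
      by simp
  qed
  moreover have "Z \<ge> 0"
    by (simp add: Z_def)
  ultimately show ?thesis by simp
qed

lemma gibbs_eq: "gibbs U = density lborel (\<lambda>x. ennreal (exp (- U x) / Z))"
  by (simp add: gibbs_def Z_def)

lemma sets_gibbs [measurable_cong, simp]: "sets (gibbs U) = sets borel"
  by (simp add: gibbs_eq)

lemma space_gibbs [simp]: "space (gibbs U) = UNIV"
  by (simp add: gibbs_eq)

lemma integrable_gibbs_norm_power: "integrable (gibbs U) (\<lambda>x. norm x ^ k)"
  using Z_pos integrable_norm_power_exp_U[of k, THEN integrable_mult_right, of "1 / Z"]
  by (simp add: gibbs_eq integrable_density mult_ac)

lemma prob_space_gibbs: "prob_space (gibbs U)"
proof
  have "integrable lborel (\<lambda>x. exp (- U x) / Z)"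
    using integrable_norm_power_exp_U[of 0] by simp
  moreover have "(\<integral>x. exp (- U x) / Z \<partial>lborel) = 1"
    using Z_pos by (simp add: Z_def)
  ultimately have "(\<integral>\<^sup>+x. ennreal (exp (- U x) / Z) \<partial>lborel) = 1"
    using Z_pos by (simp add: nn_integral_eq_integral)
  then show "emeasure (gibbs U) (space (gibbs U)) = 1"
    by (simp add: gibbs_eq emeasure_density)
qed

lemma gibbs_P2: "gibbs U \<in> P2"
  using integrable_gibbs_norm_power[of 2] prob_space_gibbs
  by (simp add: P2_def nn_integral_eq_integral)

lemma nn_integral_gibbs:
  assumes "f \<in> borel_measurable borel"
  shows "(\<integral>\<^sup>+x. f x \<partial>gibbs U) = (\<integral>\<^sup>+x. ennreal (exp (- U x) / Z) * f x \<partial>lborel)"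
  using assms by (simp add: gibbs_eq nn_integral_density)

text \<open>Acceptance probability of the random walk Metropolis chain with target \<open>gibbs U\<close>.\<close>

definition acc :: "'a \<Rightarrow> 'a \<Rightarrow> real" where
  "acc y z = min 1 (exp (U y - U (y + z)))"

lemma acc_bounds: "0 \<le> acc y z" "acc y z \<le> 1"
  by (simp_all add: acc_def)

lemma measurable_acc [measurable (raw)]:
  assumes [measurable]: "f \<in> borel_measurable M" "g \<in> borel_measurable M"
  shows "(\<lambda>x. acc (f x) (g x)) \<in> borel_measurable M"
  unfolding acc_def by measurable

text \<open>The density of moving from y to u by an accepted proposal is min(exp(-U y), exp(-U u)) /
  Z times the Gaussian density of u - y, which is symmetric in y and u. Exchanging the two variables
  by Tonelli therefore trades a test function of the new position for one of the old position.
  Rejected moves leave the position unchanged and are added later.\<close>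

lemma detailed_balance:
  fixes f :: "'a \<Rightarrow> ennreal"
  assumes [measurable]: "f \<in> borel_measurable borel"
  shows "(\<integral>\<^sup>+y. \<integral>\<^sup>+z. ennreal (acc y z) * f (y + z) \<partial>gauss h \<partial>gibbs U)
    = (\<integral>\<^sup>+y. \<integral>\<^sup>+z. ennreal (acc y z) * f y \<partial>gauss h \<partial>gibbs U)"
proof -
  define q where "q y u = ennreal (min (exp (- U y)) (exp (- U u)) / Z * gauss_density h (u - y))" for y u
  have [measurable (raw)]: "(\<lambda>x. q (f x) (g x)) \<in> borel_measurable M"
    if [measurable]: "f \<in> borel_measurable M" "g \<in> borel_measurable M" for f g and M :: "'b measure"
    unfolding q_def by measurable
  have sym: "q y u = q u y" for y u
    by (simp add: q_def gauss_density_def min.commute norm_minus_commute)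
  have q: "ennreal (exp (- U y) / Z) * (ennreal (gauss_density h z) * (ennreal (acc y z) * c)) = q y (y + z) * c" for y z c
  proof -
    have "exp (- U y) * acc y z = min (exp (- U y)) (exp (- U (y + z)))"
      by (simp add: acc_def min_mult_distrib_left flip: exp_add)
    then have "exp (- U y) / Z * gauss_density h z * acc y z = min (exp (- U y)) (exp (- U (y + z))) / Z * gauss_density h (y + z - y)"
      by (simp add: field_simps)
    moreover have "ennreal (exp (- U y) / Z) * (ennreal (gauss_density h z) * (ennreal (acc y z) * c))
        = ennreal (exp (- U y) / Z * gauss_density h z * acc y z) * c"
    proof -
      have "ennreal a * (ennreal b * (ennreal d * c)) = ennreal (a * b * d) * c" if "0 \<le> a" "0 \<le> b" "0 \<le> d" for a b d
        using that by (simp add: ennreal_mult mult.assoc)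
      then show ?thesis
        using Z_pos acc_bounds[of y z] by simp
    qed
    ultimately show ?thesis
      by (simp only: q_def)
  qed
  have E: "(\<integral>\<^sup>+y. \<integral>\<^sup>+z. ennreal (acc y z) * F (y, y + z) \<partial>gauss h \<partial>gibbs U) = (\<integral>\<^sup>+y. \<integral>\<^sup>+u. q y u * F (y, u) \<partial>lborel \<partial>lborel)"
    if [measurable]: "F \<in> borel_measurable (borel \<Otimes>\<^sub>M borel)" for F
  proof -
    have "(\<integral>\<^sup>+y. \<integral>\<^sup>+z. ennreal (acc y z) * F (y, y + z) \<partial>gauss h \<partial>gibbs U)
      = (\<integral>\<^sup>+y. \<integral>\<^sup>+z. ennreal (exp (- U y) / Z) * (ennreal (gauss_density h z) * (ennreal (acc y z) * F (y, y + z))) \<partial>lborel \<partial>lborel)"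
      by (simp add: nn_integral_gauss nn_integral_gibbs nn_integral_cmult)
    also have "\<dots> = (\<integral>\<^sup>+y. \<integral>\<^sup>+z. q y (y + z) * F (y, y + z) \<partial>lborel \<partial>lborel)"
      by (simp only: q)
    also have "\<dots> = (\<integral>\<^sup>+y. \<integral>\<^sup>+u. q y u * F (y, u) \<partial>lborel \<partial>lborel)"
      by (intro nn_integral_cong nn_integral_lborel_translate[where f="\<lambda>u. q _ u * F (_, u)"]) measurable
    finally show ?thesis .
  qed
  have "(\<integral>\<^sup>+y. \<integral>\<^sup>+z. ennreal (acc y z) * f (y + z) \<partial>gauss h \<partial>gibbs U) = (\<integral>\<^sup>+y. \<integral>\<^sup>+u. q y u * f u \<partial>lborel \<partial>lborel)"
    using E[of "\<lambda>p. f (snd p)"] by simp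
  also have "\<dots> = (\<integral>\<^sup>+u. \<integral>\<^sup>+y. q y u * f u \<partial>lborel \<partial>lborel)"
    by (rule lborel_pair.Fubini') measurable
  also have "\<dots> = (\<integral>\<^sup>+u. \<integral>\<^sup>+y. q u y * f u \<partial>lborel \<partial>lborel)"
    by (simp only: sym)
  also have "\<dots> = (\<integral>\<^sup>+y. \<integral>\<^sup>+z. ennreal (acc y z) * f y \<partial>gauss h \<partial>gibbs U)"
    using E[of "\<lambda>p. f (fst p)"] by simp
  finally show ?thesis .
qed

end

section \<open>Couplings and the Metropolis step\<close>

lemma couplingsD:
  fixes \<mu> \<nu> :: "'a::euclidean_space measure"
  assumes \<xi>: "\<xi> \<in> couplings \<mu> \<nu>"
  shows "sets \<xi> = sets (borel \<Otimes>\<^sub>M borel)" "distr \<xi> borel fst = \<mu>" "distr \<xi> borel snd = \<nu>"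
    "fst \<in> borel_measurable \<xi>" "snd \<in> borel_measurable \<xi>"
proof -
  show s: "sets \<xi> = sets (borel \<Otimes>\<^sub>M borel)" and "distr \<xi> borel fst = \<mu>" "distr \<xi> borel snd = \<nu>"
    using \<xi> by (auto simp: couplings_def)
  show "fst \<in> borel_measurable \<xi>" "snd \<in> borel_measurable \<xi>"
    by (simp_all add: s cong: measurable_cong_sets)
qed

lemma couplings_integrable:
  fixes f :: "'a::euclidean_space \<Rightarrow> real"
  assumes \<xi>: "\<xi> \<in> couplings \<mu> \<nu>" and f: "f \<in> borel_measurable borel"
  shows "integrable \<mu> f \<Longrightarrow> integrable \<xi> (\<lambda>p. f (fst p))"
    and "integrable \<nu> f \<Longrightarrow> integrable \<xi> (\<lambda>p. f (snd p))"
    and "(\<integral>p. f (fst p) \<partial>\<xi>) = (\<integral>x. f x \<partial>\<mu>)"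
    and "(\<integral>p. f (snd p) \<partial>\<xi>) = (\<integral>y. f y \<partial>\<nu>)"
proof -
  note D = couplingsD[OF \<xi>]
  show "integrable \<mu> f \<Longrightarrow> integrable \<xi> (\<lambda>p. f (fst p))"
    using integrable_distr_eq[OF D(4) f] D by simp
  show "integrable \<nu> f \<Longrightarrow> integrable \<xi> (\<lambda>p. f (snd p))"
    using integrable_distr_eq[OF D(5) f] D by simp
  show "(\<integral>p. f (fst p) \<partial>\<xi>) = (\<integral>x. f x \<partial>\<mu>)"
    using integral_distr[OF D(4) f] D by simp
  show "(\<integral>p. f (snd p) \<partial>\<xi>) = (\<integral>y. f y \<partial>\<nu>)"
    using integral_distr[OF D(5) f] D by simp
qed

lemma couplings_prob_space:
  assumes "\<xi> \<in> couplings \<mu> \<nu>" "prob_space \<mu>"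
  shows "prob_space \<xi>"
  using assms couplingsD[OF assms(1)] by (metis prob_space_distrD)

text \<open>A real number, so that estimates can be added and subtracted freely. For couplings of
  measures in \<open>P2\<close> the squared distance is integrable, and
  \<open>nn_integral_cost\<close> identifies this with the extended cost occurring in
  \<open>W2\<close>.\<close>

definition cost :: "('a::euclidean_space \<times> 'a) measure \<Rightarrow> real" where
  "cost \<xi> = (\<integral>p. (norm (fst p - snd p))\<^sup>2 \<partial>\<xi>)"

lemma cost_nonneg [simp]: "0 \<le> cost \<xi>"
  by (simp add: cost_def)

lemma integrable_cost:
  assumes \<xi>: "\<xi> \<in> couplings \<mu> \<nu>" and "\<mu> \<in> P2" "\<nu> \<in> P2"
  shows "integrable \<xi> (\<lambda>p. (norm (fst p - snd p))\<^sup>2)"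
proof (rule Bochner_Integration.integrable_bound)
  note [measurable_cong] = couplingsD(1)[OF \<xi>]
  show "integrable \<xi> (\<lambda>p. 2 * (norm (fst p))\<^sup>2 + 2 * (norm (snd p))\<^sup>2)"
    using P2D(4)[OF assms(2)] P2D(4)[OF assms(3)] couplings_integrable(1,2)[OF \<xi>, of "\<lambda>x. (norm x)\<^sup>2"]
    by (intro Bochner_Integration.integrable_add integrable_mult_right) simp_all
  show "(\<lambda>p. (norm (fst p - snd p))\<^sup>2) \<in> borel_measurable \<xi>"
    by measurable
  show "AE p in \<xi>. norm ((norm (fst p - snd p))\<^sup>2) \<le> norm (2 * (norm (fst p))\<^sup>2 + 2 * (norm (snd p))\<^sup>2)"
    using norm_add_square_le[of "fst _" "- snd _"] by (intro AE_I2) simp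
qed

lemma nn_integral_cost:
  assumes \<xi>: "\<xi> \<in> couplings \<mu> \<nu>" and "\<mu> \<in> P2" "\<nu> \<in> P2"
  shows "(\<integral>\<^sup>+(x, y). ennreal ((norm (x - y))\<^sup>2) \<partial>\<xi>) = ennreal (cost \<xi>)"
  using nn_integral_eq_integral[OF integrable_cost[OF assms]] by (simp add: cost_def split_beta')

lemma W2_power2: "(W2 \<mu> \<nu>)\<^sup>2 = (INF \<xi>\<in>couplings \<mu> \<nu>. \<integral>\<^sup>+(x, y). ennreal ((norm (x - y))\<^sup>2) \<partial>\<xi>)"
  by (simp add: W2_def esqrt_power2)

lemma W2_power2_le_cost:
  assumes "\<xi> \<in> couplings \<mu> \<nu>" "\<mu> \<in> P2" "\<nu> \<in> P2"
  shows "(W2 \<mu> \<nu>)\<^sup>2 \<le> ennreal (cost \<xi>)"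
  unfolding W2_power2 using assms(1) by (rule INF_lower2) (simp add: nn_integral_cost[OF assms])

text \<open>Near-optimal couplings are enough for the one-step estimate, so no compactness argument
  for a minimiser enters. The product coupling shows that the infimum is finite, which makes adding
  \<open>e\<close> a strict increase.\<close>

lemma cost_le_W2_power2:
  assumes \<mu>: "\<mu> \<in> P2" and \<nu>: "\<nu> \<in> P2" and "e > 0"
  obtains \<xi> where "\<xi> \<in> couplings \<mu> \<nu>" "(W2 \<mu> \<nu>)\<^sup>2 < \<infinity>" "cost \<xi> \<le> enn2real ((W2 \<mu> \<nu>)\<^sup>2) + e"
proof -
  interpret M: prob_space \<mu> using \<mu> by (rule P2D)
  interpret N: prob_space \<nu> using \<nu> by (rule P2D)
  interpret pair_prob_space \<mu> \<nu> ..
  note s = P2D(2)[OF \<mu>] P2D(2)[OF \<nu>]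
  note [measurable_cong] = s
  have "distr (\<mu> \<Otimes>\<^sub>M \<nu>) borel snd = distr (\<nu> \<Otimes>\<^sub>M \<mu>) borel fst"
    by (subst distr_pair_swap, subst distr_distr) (auto intro!: distr_cong)
  also have "\<dots> = \<nu>"
    using M.distr_pair_fst[of \<nu>] s by (simp cong: distr_cong)
  finally have "distr (\<mu> \<Otimes>\<^sub>M \<nu>) borel snd = \<nu>" .
  then have \<xi>0: "\<mu> \<Otimes>\<^sub>M \<nu> \<in> couplings \<mu> \<nu>"
    using s N.distr_pair_fst[of \<mu>] unfolding couplings_def
    by (auto simp: sets_pair_measure_cong[OF s] cong: distr_cong)
  have fin: "(W2 \<mu> \<nu>)\<^sup>2 < \<infinity>"
    using W2_power2_le_cost[OF \<xi>0 \<mu> \<nu>] ennreal_less_top le_less_trans by (metis infinity_ennreal_def)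
  have "(W2 \<mu> \<nu>)\<^sup>2 < ennreal (enn2real ((W2 \<mu> \<nu>)\<^sup>2) + e)"
    using fin \<open>e > 0\<close> by (metis ennreal_enn2real ennreal_less_iff enn2real_nonneg infinity_ennreal_def less_add_same_cancel1)
  then obtain \<xi> where \<xi>: "\<xi> \<in> couplings \<mu> \<nu>"
    and "(\<integral>\<^sup>+(x, y). ennreal ((norm (x - y))\<^sup>2) \<partial>\<xi>) < ennreal (enn2real ((W2 \<mu> \<nu>)\<^sup>2) + e)"
    unfolding W2_power2[of \<mu> \<nu>] INF_less_iff by blast
  then have "cost \<xi> < enn2real ((W2 \<mu> \<nu>)\<^sup>2) + e"
    by (simp add: nn_integral_cost[OF \<xi> \<mu> \<nu>] ennreal_less_iff)
  then show ?thesis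
    using that[OF \<xi> fin] by simp
qed

section \<open>The coupled Metropolis step and its marginals\<close>

context smooth_convex_potential
begin

text \<open>The first coordinate makes a Gaussian step, the second one proposes the same step and
  accepts it with probability \<open>acc\<close>; the boolean records the decision.\<close>

definition metropolis :: "real \<Rightarrow> ('a \<times> 'a) measure \<Rightarrow> ('a \<times> 'a) measure" where
  "metropolis h \<xi> = distr
     (density ((\<xi> \<Otimes>\<^sub>M gauss h) \<Otimes>\<^sub>M count_space (UNIV :: bool set))
       (\<lambda>w. ennreal (if snd w then acc (snd (fst (fst w))) (snd (fst w)) else 1 - acc (snd (fst (fst w))) (snd (fst w)))))
     (borel \<Otimes>\<^sub>M borel)
     (\<lambda>w. (fst (fst (fst w)) + snd (fst w), if snd w then snd (fst (fst w)) + snd (fst w) else snd (fst (fst w))))"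

lemma sets_metropolis [measurable_cong, simp]: "sets (metropolis h \<xi>) = sets (borel \<Otimes>\<^sub>M borel)"
  by (simp add: metropolis_def)

lemma nn_integral_metropolis:
  fixes f :: "'a \<times> 'a \<Rightarrow> ennreal"
  assumes h: "h > 0" and [measurable_cong]: "sets \<xi> = sets (borel \<Otimes>\<^sub>M borel)"
    and [measurable]: "f \<in> borel_measurable (borel \<Otimes>\<^sub>M borel)"
  shows "(\<integral>\<^sup>+p. f p \<partial>metropolis h \<xi>) = (\<integral>\<^sup>+p. \<integral>\<^sup>+z. ennreal (acc (snd p) z) * f (fst p + z, snd p + z)
      + ennreal (1 - acc (snd p) z) * f (fst p + z, snd p) \<partial>gauss h \<partial>\<xi>)"
proof -
  interpret N: prob_space "gauss h :: 'a measure"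
    using h by (rule prob_space_gauss)
  interpret B: sigma_finite_measure "count_space (UNIV :: bool set)"
    by (rule sigma_finite_measure_count_space)
  have [measurable]: "(\<lambda>w. ennreal (if snd w then acc (snd (fst (fst w))) (snd (fst w)) else 1 - acc (snd (fst (fst w))) (snd (fst w))))
    \<in> borel_measurable ((\<xi> \<Otimes>\<^sub>M gauss h) \<Otimes>\<^sub>M count_space (UNIV :: bool set))"
    by measurable
  have [measurable]: "(\<lambda>w. (fst (fst (fst w)) + snd (fst w), if snd w then snd (fst (fst w)) + snd (fst w) else snd (fst (fst w))))
    \<in> (\<xi> \<Otimes>\<^sub>M gauss h) \<Otimes>\<^sub>M count_space (UNIV :: bool set) \<rightarrow>\<^sub>M borel \<Otimes>\<^sub>M borel"
    by measurable
  have bool: "(\<integral>\<^sup>+b. g b \<partial>count_space UNIV) = g True + g False" for g :: "bool \<Rightarrow> ennreal"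
    by (simp add: nn_integral_count_space_finite UNIV_bool add.commute)
  show ?thesis
    unfolding metropolis_def
    by (subst nn_integral_distr, measurable, subst nn_integral_density, measurable,
        subst B.nn_integral_fst[symmetric], measurable, subst N.nn_integral_fst[symmetric], measurable)
      (simp add: bool)
qed

lemma acc_complement: "ennreal (acc y z) * c + ennreal (1 - acc y z) * c = c"
proof -
  have "ennreal (acc y z) + ennreal (1 - acc y z) = 1"
    using acc_bounds[of y z] by (simp flip: ennreal_plus)
  then show ?thesis
    by (metis distrib_right mult_1)
qed

text \<open>The first coordinate moves by z under either decision, and the two weights sum to 1, so
  its law is the exact heat flow. For the second coordinate, detailed balance replaces the accepted
  new position by the old one; the weights of acceptance and rejection then recombine to 1 and leave
  the Gibbs measure.\<close>

lemma metropolis_coupling: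
  assumes h: "h > 0" and \<xi>: "\<xi> \<in> couplings \<nu> (gibbs U)"
  shows "metropolis h \<xi> \<in> couplings (heat h \<nu>) (gibbs U)"
proof -
  note D = couplingsD[OF \<xi>]
  note [measurable_cong] = D(1)
  interpret N: prob_space "gauss h :: 'a measure"
    using h by (rule prob_space_gauss)
  have sv: "sets \<nu> = sets borel"
    using D(2) by (metis sets_distr)
  have nn_fst: "(\<integral>\<^sup>+p. f (fst p) \<partial>\<xi>) = (\<integral>\<^sup>+x. f x \<partial>\<nu>)" if "f \<in> borel_measurable borel" for f
    using that nn_integral_distr[OF D(4), of f] by (simp add: D(2) sv cong: measurable_cong_sets)
  have nn_snd: "(\<integral>\<^sup>+p. f (snd p) \<partial>\<xi>) = (\<integral>\<^sup>+x. f x \<partial>gibbs U)" if "f \<in> borel_measurable borel" for f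
    using that nn_integral_distr[OF D(5), of f] by (simp add: D(3) cong: measurable_cong_sets)
  have "(\<integral>\<^sup>+p. f (fst p) \<partial>metropolis h \<xi>) = (\<integral>\<^sup>+x. f x \<partial>heat h \<nu>)" if [measurable]: "f \<in> borel_measurable borel" for f
  proof -
    have "(\<integral>\<^sup>+p. f (fst p) \<partial>metropolis h \<xi>) = (\<integral>\<^sup>+p. \<integral>\<^sup>+z. f (fst p + z) \<partial>gauss h \<partial>\<xi>)"
      by (simp add: nn_integral_metropolis h D(1) acc_complement)
    also have "\<dots> = (\<integral>\<^sup>+x. f x \<partial>heat h \<nu>)"
      by (simp add: nn_integral_heat h sv nn_fst[of "\<lambda>x. \<integral>\<^sup>+z. f (x + z) \<partial>gauss h"])
    finally show ?thesis .
  qed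
  note F = this
  have "(\<integral>\<^sup>+p. f (snd p) \<partial>metropolis h \<xi>) = (\<integral>\<^sup>+x. f x \<partial>gibbs U)" if [measurable]: "f \<in> borel_measurable borel" for f
  proof -
    have "(\<integral>\<^sup>+p. f (snd p) \<partial>metropolis h \<xi>)
      = (\<integral>\<^sup>+p. \<integral>\<^sup>+z. ennreal (acc (snd p) z) * f (snd p + z) + ennreal (1 - acc (snd p) z) * f (snd p) \<partial>gauss h \<partial>\<xi>)"
      by (simp add: nn_integral_metropolis h D(1))
    also have "\<dots> = (\<integral>\<^sup>+y. \<integral>\<^sup>+z. ennreal (acc y z) * f (y + z) + ennreal (1 - acc y z) * f y \<partial>gauss h \<partial>gibbs U)"
      by (rule nn_snd) measurable
    also have "\<dots> = (\<integral>\<^sup>+y. \<integral>\<^sup>+z. ennreal (acc y z) * f (y + z) \<partial>gauss h \<partial>gibbs U)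
        + (\<integral>\<^sup>+y. \<integral>\<^sup>+z. ennreal (1 - acc y z) * f y \<partial>gauss h \<partial>gibbs U)"
      by (simp add: nn_integral_add)
    also have "\<dots> = (\<integral>\<^sup>+y. \<integral>\<^sup>+z. ennreal (acc y z) * f y \<partial>gauss h \<partial>gibbs U)
        + (\<integral>\<^sup>+y. \<integral>\<^sup>+z. ennreal (1 - acc y z) * f y \<partial>gauss h \<partial>gibbs U)"
      by (simp only: detailed_balance[OF that])
    also have "\<dots> = (\<integral>\<^sup>+y. \<integral>\<^sup>+z. ennreal (acc y z) * f y + ennreal (1 - acc y z) * f y \<partial>gauss h \<partial>gibbs U)"
      by (simp add: nn_integral_add)
    also have "\<dots> = (\<integral>\<^sup>+y. f y \<partial>gibbs U)"
      using N.emeasure_space_1 by (simp add: acc_complement)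
    finally show ?thesis .
  qed
  note S = this
  show ?thesis
    unfolding couplings_def
  proof (intro CollectI conjI measure_eqI)
    fix A assume "A \<in> sets (distr (metropolis h \<xi>) borel fst)"
    then have [measurable]: "A \<in> sets borel" by simp
    have "emeasure (distr (metropolis h \<xi>) borel fst) A = (\<integral>\<^sup>+x. indicator A x \<partial>distr (metropolis h \<xi>) borel fst)"
      by simp
    also have "\<dots> = (\<integral>\<^sup>+p. indicator A (fst p) \<partial>metropolis h \<xi>)"
      by (subst nn_integral_distr) simp_all
    finally show "emeasure (distr (metropolis h \<xi>) borel fst) A = emeasure (heat h \<nu>) A"
      by (simp add: F)
  next
    fix A assume "A \<in> sets (distr (metropolis h \<xi>) borel snd)"
    then have [measurable]: "A \<in> sets borel" by simp
    have "emeasure (distr (metropolis h \<xi>) borel snd) A = (\<integral>\<^sup>+x. indicator A x \<partial>distr (metropolis h \<xi>) borel snd)"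
      by simp
    also have "\<dots> = (\<integral>\<^sup>+p. indicator A (snd p) \<partial>metropolis h \<xi>)"
      by (subst nn_integral_distr) simp_all
    finally show "emeasure (distr (metropolis h \<xi>) borel snd) A = emeasure (gibbs U) A"
      by (simp add: S)
  qed simp_all
qed

end

section \<open>Cost of one Metropolis step\<close>

lemma one_minus_exp_bounds:
  fixes t :: real
  assumes "0 \<le> t"
  shows "1 - exp (- t) \<le> t" "t - t\<^sup>2 / 2 \<le> 1 - exp (- t)"
proof -
  show "1 - exp (- t) \<le> t"
    using exp_ge_add_one_self[of "- t"] by simp
  \<comment> \<open>The product equals 1 + t^4 / 4. Replacing its second factor by the larger exp t
    gives the upper Taylor bound exp(-t) \<le> 1 - t + t^2 / 2.\<close>
  have "1 \<le> (1 - t + t\<^sup>2 / 2) * (1 + t + t\<^sup>2 / 2)"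
  proof -
    have "(1 - t + t\<^sup>2 / 2) * (1 + t + t\<^sup>2 / 2) = 1 + (t\<^sup>2)\<^sup>2 / 4"
      by (simp add: algebra_simps power2_eq_square)
    then show ?thesis by simp
  qed
  also have "\<dots> \<le> (1 - t + t\<^sup>2 / 2) * exp t"
  proof (rule mult_left_mono)
    show "1 + t + t\<^sup>2 / 2 \<le> exp t"
      using assms by (rule exp_lower_Taylor_quadratic)
    have "0 \<le> (1 - t)\<^sup>2"
      by simp
    then show "0 \<le> 1 - t + t\<^sup>2 / 2"
      by (simp add: power2_diff)
  qed
  finally have "exp (- t) \<le> 1 - t + t\<^sup>2 / 2"
    by (simp add: exp_minus field_simps)
  then show "t - t\<^sup>2 / 2 \<le> 1 - exp (- t)"
    by simp
qed

context smooth_convex_potential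
begin

text \<open>A rejection has probability 1 - exp(-t), where t is the positive part of the increment
  of \<open>U\<close>. The increment lies within L/2 |z|^2 of its linear part, and 1 - exp(-t) lies
  within t^2 / 2 of t. The crude first bound is used where the rejection already multiplies |z|^2;
  the first-order expansion is needed where it multiplies only (x - y) \<bullet> z.\<close>

lemma rejection_bounds:
  defines "v \<equiv> \<lambda>y. gradient U y"
  shows "1 - acc y z \<le> norm (v y) * norm z + L / 2 * (norm z)\<^sup>2"
    and "\<bar>(1 - acc y z) - max 0 (v y \<bullet> z)\<bar>
      \<le> (norm (v y))\<^sup>2 * (norm z)\<^sup>2 + L\<^sup>2 / 4 * norm z ^ 4 + L / 2 * (norm z)\<^sup>2"
proof -
  define \<Delta> where "\<Delta> = U (y + z) - U y"
  define t where "t = max 0 \<Delta>"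
  define a b where "a = norm (v y) * norm z" and "b = L / 2 * (norm z)\<^sup>2"
  have ab: "0 \<le> a" "0 \<le> b"
    using L_nonneg by (simp_all add: a_def b_def)
  have lo: "v y \<bullet> z \<le> \<Delta>" and hi: "\<Delta> \<le> v y \<bullet> z + b"
    using convex_lower_bound[of y "y + z"] upper_bound[of "y + z" y] by (simp_all add: \<Delta>_def v_def b_def)
  have cs: "\<bar>v y \<bullet> z\<bar> \<le> a"
    unfolding a_def by (rule Cauchy_Schwarz_ineq2)
  have r: "1 - acc y z = 1 - exp (- t)"
    by (simp add: acc_def t_def \<Delta>_def max_def min_def)
  have t: "0 \<le> t" "t \<le> a + b" "\<bar>t - max 0 (v y \<bullet> z)\<bar> \<le> b"
    using lo hi cs ab by (auto simp: t_def)
  have "t\<^sup>2 \<le> (a + b)\<^sup>2"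
    using t by (intro power_mono)
  also have "\<dots> \<le> 2 * a\<^sup>2 + 2 * b\<^sup>2"
    using zero_le_power2[of "a - b"] unfolding power2_diff power2_sum by linarith
  finally have t2: "t\<^sup>2 / 2 \<le> a\<^sup>2 + b\<^sup>2"
    by simp
  note e = one_minus_exp_bounds[OF t(1)]
  show "1 - acc y z \<le> norm (v y) * norm z + L / 2 * (norm z)\<^sup>2"
    using e(1) t(2) by (simp add: r a_def b_def)
  have "\<bar>(1 - acc y z) - max 0 (v y \<bullet> z)\<bar> \<le> a\<^sup>2 + b\<^sup>2 + b"
    using e t(3) t2 unfolding r by linarith
  also have "b\<^sup>2 = L\<^sup>2 / 4 * norm z ^ 4"
    by (simp add: b_def power_mult_distrib power_divide flip: power_mult)
  finally show "\<bar>(1 - acc y z) - max 0 (v y \<bullet> z)\<bar>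
      \<le> (norm (v y))\<^sup>2 * (norm z)\<^sup>2 + L\<^sup>2 / 4 * norm z ^ 4 + L / 2 * (norm z)\<^sup>2"
    by (simp add: a_def b_def power_mult_distrib)
qed

text \<open>Splitting \<open>max 0 s = (s + \<bar>s\<bar>) / 2\<close> leaves a covariance term, which produces the drift
  \<open>h *\<^sub>R gradient U y\<close>, and a term that is odd in \<open>z\<close>.\<close>

lemma metropolis_integrand_le:
  fixes x y z :: 'a
  defines "D \<equiv> x - y" and "v \<equiv> gradient U y"
  shows "acc y z * (norm D)\<^sup>2 + (1 - acc y z) * (norm (x + z - y))\<^sup>2
    \<le> (norm D)\<^sup>2 + (z \<bullet> D) * (z \<bullet> v) + (z \<bullet> D) * \<bar>z \<bullet> v\<bar>
      + (2 * norm D * ((norm v)\<^sup>2 + L / 2) + norm v) * norm z ^ 3 + L / 2 * norm z ^ 4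
      + 2 * norm D * (L\<^sup>2 / 4) * norm z ^ 5"
proof -
  define r where "r = 1 - acc y z"
  define n where "n = norm z"
  define s where "s = v \<bullet> z"
  have r: "0 \<le> r" "r \<le> norm v * n + L / 2 * n\<^sup>2"
    "\<bar>r - max 0 s\<bar> \<le> (norm v)\<^sup>2 * n\<^sup>2 + L\<^sup>2 / 4 * n ^ 4 + L / 2 * n\<^sup>2"
    using rejection_bounds[of y z] acc_bounds[of y z] by (simp_all add: r_def n_def v_def s_def)
  have "(norm (x + z - y))\<^sup>2 = (norm D)\<^sup>2 + 2 * (D \<bullet> z) + n\<^sup>2"
    unfolding power2_norm_eq_inner n_def D_def by (simp add: inner_diff inner_add inner_commute algebra_simps)
  then have "acc y z * (norm D)\<^sup>2 + (1 - acc y z) * (norm (x + z - y))\<^sup>2 = (norm D)\<^sup>2 + 2 * (D \<bullet> z) * r + r * n\<^sup>2"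
    by (simp add: r_def algebra_simps)
  moreover have "2 * (D \<bullet> z) * r = 2 * (D \<bullet> z) * max 0 s + 2 * (D \<bullet> z) * (r - max 0 s)"
    by (simp add: algebra_simps)
  moreover have "2 * (D \<bullet> z) * max 0 s = (z \<bullet> D) * (z \<bullet> v) + (z \<bullet> D) * \<bar>z \<bullet> v\<bar>"
    by (simp add: s_def inner_commute max_def algebra_simps)
  moreover have "2 * (D \<bullet> z) * (r - max 0 s)
      \<le> 2 * (norm D * n) * ((norm v)\<^sup>2 * n\<^sup>2 + L\<^sup>2 / 4 * n ^ 4 + L / 2 * n\<^sup>2)"
  proof -
    have "2 * (D \<bullet> z) * (r - max 0 s) \<le> \<bar>2 * (D \<bullet> z)\<bar> * \<bar>r - max 0 s\<bar>"
      by (simp only: abs_mult[symmetric] abs_ge_self)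
    also have "\<dots> \<le> 2 * (norm D * n) * ((norm v)\<^sup>2 * n\<^sup>2 + L\<^sup>2 / 4 * n ^ 4 + L / 2 * n\<^sup>2)"
      using Cauchy_Schwarz_ineq2[of D z] r(3) by (intro mult_mono) (auto simp: n_def)
    finally show ?thesis .
  qed
  moreover have "r * n\<^sup>2 \<le> (norm v * n + L / 2 * n\<^sup>2) * n\<^sup>2"
    using r by (intro mult_right_mono) simp_all
  ultimately show ?thesis
    unfolding n_def[symmetric] by (simp add: algebra_simps power2_eq_square power3_eq_cube eval_nat_numeral)
qed

definition noise_moment :: "nat \<Rightarrow> real" where
  "noise_moment k = (\<integral>z. norm (z::'a) ^ k \<partial>gauss 1)"

lemma noise_moment_nonneg: "0 \<le> noise_moment k"
  by (simp add: noise_moment_def)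

lemma integrable_metropolis_integrand:
  assumes "h > 0"
  shows "integrable (gauss h) (\<lambda>z. acc y z * (norm (x - y))\<^sup>2 + (1 - acc y z) * (norm (x + z - y))\<^sup>2)"
proof (rule integrable_gauss_bound[OF assms])
  fix z :: 'a
  define d where "d = (norm (x - y))\<^sup>2"
  have d: "0 \<le> d"
    by (simp add: d_def)
  have "(norm (x + z - y))\<^sup>2 \<le> 2 * d + 2 * (norm z)\<^sup>2"
    using norm_add_square_le[of "x - y" z] by (simp add: d_def algebra_simps)
  then have "(1 - acc y z) * (norm (x + z - y))\<^sup>2 \<le> 1 * (2 * d + 2 * (norm z)\<^sup>2)"
    using acc_bounds[of y z] by (intro mult_mono) simp_all
  moreover have "acc y z * d \<le> 1 * d"
    using acc_bounds[of y z] d by (intro mult_right_mono)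
  moreover have "0 \<le> d * (norm z)\<^sup>2"
    using d by simp
  ultimately have "acc y z * d + (1 - acc y z) * (norm (x + z - y))\<^sup>2 \<le> (3 * d + 2) * (1 + norm z ^ 2)"
    by (simp add: algebra_simps)
  moreover have "0 \<le> acc y z * d + (1 - acc y z) * (norm (x + z - y))\<^sup>2"
    using acc_bounds[of y z] d by simp
  ultimately show "\<bar>acc y z * (norm (x - y))\<^sup>2 + (1 - acc y z) * (norm (x + z - y))\<^sup>2\<bar> \<le> (3 * d + 2) * (1 + norm z ^ 2)"
    by (simp add: d_def)
qed measurable

text \<open>The exponents are chosen for the available moments: the first marginal has only a second
  moment, while the Gibbs measure has all of them. Since the squared gradient grows like |y|^2, the
  inequality 2ab \<le> a^2 + b^2 splits the mixed product into |x - y|^2 and a term of order 1 +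
  |y|^4.\<close>

lemma error_growth:
  "\<exists>C\<ge>0. \<forall>x y. 2 * norm (x - y) * ((norm (gradient U y))\<^sup>2 + L / 2 + L\<^sup>2 / 4) + norm (gradient U y) + L / 2
      \<le> C * (1 + (norm x)\<^sup>2 + norm y ^ 4)"
proof -
  define g where "g = norm (gradient U 0)"
  define A where "A = 2 * g\<^sup>2 + 2 * L\<^sup>2 + L / 2 + L\<^sup>2 / 4"
  have A: "0 \<le> A"
    using L_nonneg by (simp add: A_def)
  have "2 * norm (x - y) * ((norm (gradient U y))\<^sup>2 + L / 2 + L\<^sup>2 / 4) + norm (gradient U y) + L / 2
      \<le> (3 + 2 * A\<^sup>2 + 2 * A + L / 2) * (1 + (norm x)\<^sup>2 + norm y ^ 4)" for x y
  proof -
    define X Y w v where "X = (norm x)\<^sup>2" and "Y = (norm y)\<^sup>2"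
      and "w = (norm (gradient U y))\<^sup>2 + L / 2 + L\<^sup>2 / 4" and "v = norm (gradient U y)"
    have nn: "0 \<le> X" "0 \<le> Y" "0 \<le> w" "0 \<le> v"
      using L_nonneg by (simp_all add: X_def Y_def w_def v_def)
    have "v\<^sup>2 \<le> (g + L * norm y)\<^sup>2"
      using gradient_growth[of y] by (intro power_mono) (simp_all add: v_def g_def)
    also have "\<dots> \<le> 2 * g\<^sup>2 + 2 * (L * norm y)\<^sup>2"
      using zero_le_power2[of "g - L * norm y"] unfolding power2_diff power2_sum by linarith
    finally have v2: "v\<^sup>2 \<le> 2 * g\<^sup>2 + 2 * L\<^sup>2 * Y"
      by (simp add: Y_def power_mult_distrib)
    have gY: "0 \<le> g\<^sup>2 * Y" "0 \<le> L * Y" "0 \<le> L\<^sup>2 * Y"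
      using nn L_nonneg by simp_all
    have w: "w \<le> A * (1 + Y)"
    proof -
      have "A * (1 + Y) = A + 2 * (g\<^sup>2 * Y) + 2 * (L\<^sup>2 * Y) + L * Y / 2 + L\<^sup>2 * Y / 4"
        by (simp add: A_def algebra_simps add_divide_distrib)
      then show ?thesis
        using v2 gY zero_le_power2[of L] unfolding w_def v_def[symmetric] A_def by linarith
    qed
    have "v\<^sup>2 \<le> w"
      using L_nonneg by (simp add: w_def v_def)
    then have "v \<le> 1 + w"
      using zero_le_power2[of "v - 1"] nn unfolding power2_diff by simp
    moreover have Y2: "Y \<le> 1 + Y\<^sup>2"
      using zero_le_power2[of "Y - 1"] nn unfolding power2_diff by simp
    have "A * Y \<le> A * (1 + Y\<^sup>2)"
      using A Y2 by (intro mult_left_mono)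
    moreover have "2 * norm (x - y) * w \<le> 2 * X + 2 * Y + 2 * A\<^sup>2 * (1 + Y\<^sup>2)"
    proof -
      have "2 * norm (x - y) * w \<le> (norm (x - y))\<^sup>2 + w\<^sup>2"
        using zero_le_power2[of "norm (x - y) - w"] unfolding power2_diff by linarith
      moreover have "(norm (x - y))\<^sup>2 \<le> 2 * X + 2 * Y"
        using norm_add_square_le[of x "- y"] by (simp add: X_def Y_def)
      moreover have "w\<^sup>2 \<le> (A * (1 + Y))\<^sup>2"
        using w nn by (intro power_mono)
      moreover have "(A * (1 + Y))\<^sup>2 \<le> 2 * A\<^sup>2 * (1 + Y\<^sup>2)"
      proof -
        have "(1 + Y)\<^sup>2 \<le> 2 * (1 + Y\<^sup>2)"
          using zero_le_power2[of "1 - Y"] unfolding power2_diff power2_sum by simp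
        then have "A\<^sup>2 * (1 + Y)\<^sup>2 \<le> A\<^sup>2 * (2 * (1 + Y\<^sup>2))"
          by (intro mult_left_mono) simp_all
        then show ?thesis
          by (simp only: power_mult_distrib mult_ac)
      qed
      ultimately show ?thesis by linarith
    qed
    ultimately have "2 * norm (x - y) * w + v + L / 2
        \<le> 2 * X + 2 * (1 + Y\<^sup>2) + 2 * A\<^sup>2 * (1 + Y\<^sup>2) + 1 + A + A * (1 + Y\<^sup>2) + L / 2"
      using w Y2 by (simp add: algebra_simps)
    also have "\<dots> \<le> (3 + 2 * A\<^sup>2 + 2 * A + L / 2) * (1 + X + Y\<^sup>2)"
    proof -
      have "0 \<le> A\<^sup>2 * X" "0 \<le> A * X" "0 \<le> L * X" "0 \<le> A * Y\<^sup>2" "0 \<le> L * Y\<^sup>2"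
        using nn A L_nonneg by simp_all
      then show ?thesis
        using nn zero_le_power2[of Y] by (simp add: algebra_simps)
    qed
    finally show ?thesis
      by (simp add: X_def Y_def w_def v_def flip: power_mult)
  qed
  moreover have "0 \<le> 3 + 2 * A\<^sup>2 + 2 * A + L / 2"
    using A L_nonneg by simp
  ultimately show ?thesis
    by blast
qed

text \<open>On acceptance both points move by z and their difference is unchanged, so only
  rejections alter the squared distance. After integration the odd term vanishes, the covariance
  term gives the drift of order h, and all remaining terms carry at least three powers of the
  noise.\<close>

lemma metropolis_drift:
  "\<exists>C\<ge>0. \<forall>h x y. 0 < h \<longrightarrow> h \<le> 1 \<longrightarrow>
     (\<integral>z. acc y z * (norm (x - y))\<^sup>2 + (1 - acc y z) * (norm (x + z - y))\<^sup>2 \<partial>gauss h)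
       \<le> (norm (x - y))\<^sup>2 + 2 * h * (U x - U y) + h * sqrt h * (C * (1 + (norm x)\<^sup>2 + norm y ^ 4))"
proof -
  obtain C where C: "C \<ge> 0" and bound: "\<And>x y. 2 * norm (x - y) * ((norm (gradient U y))\<^sup>2 + L / 2 + L\<^sup>2 / 4) + norm (gradient U y) + L / 2
      \<le> C * (1 + (norm x)\<^sup>2 + norm y ^ 4)"
    using error_growth by blast
  define M where "M = noise_moment 3 + noise_moment 4 + noise_moment 5"
  have "(\<integral>z. acc y z * (norm (x - y))\<^sup>2 + (1 - acc y z) * (norm (x + z - y))\<^sup>2 \<partial>gauss h)
       \<le> (norm (x - y))\<^sup>2 + 2 * h * (U x - U y) + h * sqrt h * ((M * C) * (1 + (norm x)\<^sup>2 + norm y ^ 4))"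
    if h: "0 < h" "h \<le> 1" for h x y
  proof -
    interpret N: prob_space "gauss h :: 'a measure"
      using h by (simp add: prob_space_gauss)
    define D v where "D = x - y" and "v = gradient U y"
    define c3 c4 c5 where "c3 = 2 * norm D * ((norm v)\<^sup>2 + L / 2) + norm v" and "c4 = L / 2"
      and "c5 = 2 * norm D * (L\<^sup>2 / 4)"
    have c: "0 \<le> c3" "0 \<le> c4" "0 \<le> c5"
      using L_nonneg by (simp_all add: c3_def c4_def c5_def)
    \<comment> \<open>With \<open>s\<close> at most 1, the factors \<open>s ^ 4\<close> and
      \<open>s ^ 5\<close> of the fourth and fifth moments are bounded by \<open>s ^ 3\<close>,
      which is the order h sqrt h of the claim.\<close>
    define s where "s = sqrt h"
    have s: "0 \<le> s" "s \<le> 1" "s ^ 3 = h * sqrt h"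
      using h by (simp_all add: s_def power3_eq_cube)
    have mom: "has_bochner_integral (gauss h) (\<lambda>z::'a. norm z ^ k) (s ^ k * noise_moment k)" for k
      using h integral_gauss_norm_power[of h k, where 'a='a] integrable_gauss_norm_power[of h k, where 'a='a]
      by (simp add: has_bochner_integral_iff noise_moment_def s_def)
    have cov: "has_bochner_integral (gauss h) (\<lambda>z::'a. (z \<bullet> D) * (z \<bullet> v)) (2 * h * (D \<bullet> v))"
      using h by (intro gauss_covariance)
    have odd: "has_bochner_integral (gauss h) (\<lambda>z::'a. (z \<bullet> D) * \<bar>z \<bullet> v\<bar>) 0"
    proof -
      have "integrable (gauss h) (\<lambda>z::'a. (z \<bullet> D) * \<bar>z \<bullet> v\<bar>)"
        by (rule Bochner_Integration.integrable_bound[OF integrable.intros[OF cov]]) (auto simp: abs_mult)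
      then show ?thesis
        by (simp add: has_bochner_integral_iff integral_gauss_odd)
    qed
    have const: "has_bochner_integral (gauss h) (\<lambda>z::'a. (norm D)\<^sup>2) ((norm D)\<^sup>2)"
      by (simp add: has_bochner_integral_iff N.prob_space[simplified])
    have rhs: "has_bochner_integral (gauss h)
      (\<lambda>z. (norm D)\<^sup>2 + (z \<bullet> D) * (z \<bullet> v) + (z \<bullet> D) * \<bar>z \<bullet> v\<bar> + c3 * norm z ^ 3 + c4 * norm z ^ 4 + c5 * norm z ^ 5)
      ((norm D)\<^sup>2 + 2 * h * (D \<bullet> v) + 0 + c3 * (s ^ 3 * noise_moment 3) + c4 * (s ^ 4 * noise_moment 4) + c5 * (s ^ 5 * noise_moment 5))"
      by (intro has_bochner_integral_add has_bochner_integral_mult_right const cov odd mom)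
    have "(\<integral>z. acc y z * (norm (x - y))\<^sup>2 + (1 - acc y z) * (norm (x + z - y))\<^sup>2 \<partial>gauss h)
      \<le> (\<integral>z. (norm D)\<^sup>2 + (z \<bullet> D) * (z \<bullet> v) + (z \<bullet> D) * \<bar>z \<bullet> v\<bar> + c3 * norm z ^ 3 + c4 * norm z ^ 4 + c5 * norm z ^ 5 \<partial>gauss h)"
      using h rhs metropolis_integrand_le[of y _ x]
      by (intro integral_mono integrable_metropolis_integrand)
        (simp_all add: has_bochner_integral_iff D_def v_def c3_def c4_def c5_def)
    also have "\<dots> = (norm D)\<^sup>2 + 2 * h * (D \<bullet> v) + (c3 * (s ^ 3 * noise_moment 3) + c4 * (s ^ 4 * noise_moment 4) + c5 * (s ^ 5 * noise_moment 5))"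
      using rhs by (simp add: has_bochner_integral_iff)
    also have "\<dots> \<le> (norm D)\<^sup>2 + 2 * h * (D \<bullet> v) + s ^ 3 * (M * (c3 + c4 + c5))"
    proof -
      have "c3 * (s ^ 3 * noise_moment 3) \<le> c3 * (s ^ 3 * M)" "c4 * (s ^ 4 * noise_moment 4) \<le> c4 * (s ^ 3 * M)"
        "c5 * (s ^ 5 * noise_moment 5) \<le> c5 * (s ^ 3 * M)"
        using s(1,2) c noise_moment_nonneg[of 3] noise_moment_nonneg[of 4] noise_moment_nonneg[of 5]
        by (auto intro!: mult_left_mono mult_mono power_decreasing simp: M_def)
      then show ?thesis
        by (simp add: algebra_simps)
    qed
    also have "\<dots> \<le> (norm D)\<^sup>2 + 2 * h * (U x - U y) + s ^ 3 * (M * (C * (1 + (norm x)\<^sup>2 + norm y ^ 4)))"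
    proof -
      \<comment> \<open>Convexity at y turns the drift of the second coordinate into a difference of
        potentials. Its mean depends only on the marginals and no longer on the coupling.\<close>
      have "D \<bullet> v \<le> U x - U y"
        using convex_lower_bound[of y x] by (simp add: D_def v_def inner_commute)
      then have "2 * h * (D \<bullet> v) \<le> 2 * h * (U x - U y)"
        using h by (intro mult_left_mono) simp_all
      moreover have "c3 + c4 + c5 \<le> C * (1 + (norm x)\<^sup>2 + norm y ^ 4)"
        using bound[of x y] by (simp add: c3_def c4_def c5_def D_def v_def algebra_simps)
      then have "s ^ 3 * (M * (c3 + c4 + c5)) \<le> s ^ 3 * (M * (C * (1 + (norm x)\<^sup>2 + norm y ^ 4)))"
        using s(1) noise_moment_nonneg by (intro mult_left_mono) (simp_all add: M_def)
      ultimately show ?thesis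
        by simp
    qed
    finally show ?thesis
      by (simp add: s(3) D_def mult.assoc)
  qed
  moreover have "0 \<le> M * C"
    using C noise_moment_nonneg by (simp add: M_def)
  ultimately show ?thesis
    by blast
qed

text \<open>The drift estimate averaged over the coupling. The second marginal is the Gibbs measure,
  so the fourth moment of y is a number depending on \<open>U\<close> alone and can be put into
  \<open>C\<close>. The constant is thus uniform in \<open>h\<close>, \<open>\<nu>\<close> and
  \<open>\<xi>\<close>, as required for summing over many steps.\<close>

lemma metropolis_cost:
  "\<exists>C\<ge>0. \<forall>h \<nu> \<xi>. 0 < h \<longrightarrow> h \<le> 1 \<longrightarrow> \<nu> \<in> P2 \<longrightarrow> \<xi> \<in> couplings \<nu> (gibbs U) \<longrightarrow>
     cost (metropolis h \<xi>) \<le> cost \<xi> + 2 * h * ((\<integral>x. U x \<partial>\<nu>) - (\<integral>y. U y \<partial>gibbs U))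
       + h * sqrt h * (C * (1 + (\<integral>x. (norm x)\<^sup>2 \<partial>\<nu>)))"
proof -
  obtain C where C: "C \<ge> 0" and drift: "\<And>h x y. 0 < h \<Longrightarrow> h \<le> 1 \<Longrightarrow>
     (\<integral>z. acc y z * (norm (x - y))\<^sup>2 + (1 - acc y z) * (norm (x + z - y))\<^sup>2 \<partial>gauss h)
       \<le> (norm (x - y))\<^sup>2 + 2 * h * (U x - U y) + h * sqrt h * (C * (1 + (norm x)\<^sup>2 + norm y ^ 4))"
    using metropolis_drift by blast
  define M4 where "M4 = (\<integral>y. norm y ^ 4 \<partial>gibbs U)"
  have M4: "0 \<le> M4"
    by (simp add: M4_def)
  have "cost (metropolis h \<xi>) \<le> cost \<xi> + 2 * h * ((\<integral>x. U x \<partial>\<nu>) - (\<integral>y. U y \<partial>gibbs U))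
       + h * sqrt h * ((C * (1 + M4)) * (1 + (\<integral>x. (norm x)\<^sup>2 \<partial>\<nu>)))"
    if h: "0 < h" "h \<le> 1" and \<nu>: "\<nu> \<in> P2" and \<xi>: "\<xi> \<in> couplings \<nu> (gibbs U)" for h \<nu> \<xi>
  proof -
    note [measurable_cong] = couplingsD(1)[OF \<xi>]
    interpret X: prob_space \<xi>
      using \<xi> P2D(1)[OF \<nu>] by (rule couplings_prob_space)
    define I where "I p z = acc (snd p) z * (norm (fst p - snd p))\<^sup>2 + (1 - acc (snd p) z) * (norm (fst p + z - snd p))\<^sup>2"
      for p :: "'a \<times> 'a" and z
    define B where "B p = (norm (fst p - snd p))\<^sup>2 + 2 * h * (U (fst p) - U (snd p))
      + h * sqrt h * (C * (1 + (norm (fst p))\<^sup>2 + norm (snd p) ^ 4))" for p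
    have I_nonneg: "0 \<le> I p z" for p z
      using acc_bounds[of "snd p" z] by (simp add: I_def)
    have IB: "(\<integral>z. I p z \<partial>gauss h) \<le> B p" for p
      using drift[OF h, of "snd p" "fst p"] by (simp add: I_def B_def)
    \<comment> \<open>Not visible from the summands, since \<open>U (fst p) - U (snd p)\<close> may
      be negative; it holds because \<open>B p\<close> dominates the integral of a nonnegative
      function. It is what allows the comparison to be made with nonnegative integrals.\<close>
    have B_nonneg: "0 \<le> B p" for p
      using IB[of p] I_nonneg by (rule order_trans[OF integral_nonneg_AE[OF AE_I2], rotated])
    define b where "b = cost \<xi> + 2 * h * ((\<integral>x. U x \<partial>\<nu>) - (\<integral>y. U y \<partial>gibbs U))
       + h * sqrt h * (C * (1 + (\<integral>x. (norm x)\<^sup>2 \<partial>\<nu>) + M4))"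
    have hb: "has_bochner_integral \<xi> B b"
    proof -
      have 1: "has_bochner_integral \<xi> (\<lambda>p. (norm (fst p - snd p))\<^sup>2) (cost \<xi>)"
        using integrable_cost[OF \<xi> \<nu> gibbs_P2] by (simp add: has_bochner_integral_iff cost_def)
      have 2: "has_bochner_integral \<xi> (\<lambda>p. U (fst p)) (\<integral>x. U x \<partial>\<nu>)"
        "has_bochner_integral \<xi> (\<lambda>p. U (snd p)) (\<integral>x. U x \<partial>gibbs U)"
        using couplings_integrable[OF \<xi> measurable_U] integrable_U[OF \<nu>] integrable_U[OF gibbs_P2]
        by (simp_all add: has_bochner_integral_iff)
      have 3: "has_bochner_integral \<xi> (\<lambda>p. (norm (fst p))\<^sup>2) (\<integral>x. (norm x)\<^sup>2 \<partial>\<nu>)"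
        using couplings_integrable[OF \<xi>, of "\<lambda>x. (norm x)\<^sup>2"] P2D(4)[OF \<nu>]
        by (simp add: has_bochner_integral_iff)
      have 4: "has_bochner_integral \<xi> (\<lambda>p. norm (snd p) ^ 4) M4"
        using couplings_integrable[OF \<xi>, of "\<lambda>x. norm x ^ 4"] integrable_gibbs_norm_power[of 4]
        by (simp add: has_bochner_integral_iff M4_def)
      have 5: "has_bochner_integral \<xi> (\<lambda>p. 1) (1 :: real)"
        by (simp add: has_bochner_integral_iff X.prob_space)
      show ?thesis
        unfolding B_def[abs_def] b_def
        by (intro has_bochner_integral_add has_bochner_integral_diff has_bochner_integral_mult_right 1 2 3 4 5)
    qed
    have "ennreal (cost (metropolis h \<xi>)) = (\<integral>\<^sup>+p. ennreal ((norm (fst p - snd p))\<^sup>2) \<partial>metropolis h \<xi>)"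
      using nn_integral_cost[OF metropolis_coupling[OF h(1) \<xi>] heat_P2[OF h(1) \<nu>] gibbs_P2] by (simp add: split_beta')
    also have "\<dots> = (\<integral>\<^sup>+p. \<integral>\<^sup>+z. ennreal (acc (snd p) z) * ennreal ((norm (fst p + z - (snd p + z)))\<^sup>2)
        + ennreal (1 - acc (snd p) z) * ennreal ((norm (fst p + z - snd p))\<^sup>2) \<partial>gauss h \<partial>\<xi>)"
      using h by (subst nn_integral_metropolis) (simp_all add: couplingsD(1)[OF \<xi>])
    also have "\<dots> = (\<integral>\<^sup>+p. \<integral>\<^sup>+z. ennreal (I p z) \<partial>gauss h \<partial>\<xi>)"
      using acc_bounds by (simp add: I_def ennreal_mult)
    also have "\<dots> = (\<integral>\<^sup>+p. ennreal (\<integral>z. I p z \<partial>gauss h) \<partial>\<xi>)"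
      using integrable_metropolis_integrand[OF h(1)] I_nonneg
      by (intro nn_integral_cong nn_integral_eq_integral) (auto simp: I_def)
    also have "\<dots> \<le> (\<integral>\<^sup>+p. ennreal (B p) \<partial>\<xi>)"
      by (intro nn_integral_mono ennreal_leI IB)
    also have "\<dots> = ennreal b"
      using hb B_nonneg by (simp add: nn_integral_eq_integral has_bochner_integral_iff)
    finally have "ennreal (cost (metropolis h \<xi>)) \<le> ennreal b" .
    moreover have "0 \<le> b"
      using hb Bochner_Integration.integral_nonneg[of \<xi> B, OF B_nonneg] by (simp add: has_bochner_integral_iff)
    ultimately have "cost (metropolis h \<xi>) \<le> b"
      by simp
    also have "b \<le> cost \<xi> + 2 * h * ((\<integral>x. U x \<partial>\<nu>) - (\<integral>y. U y \<partial>gibbs U))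
       + h * sqrt h * ((C * (1 + M4)) * (1 + (\<integral>x. (norm x)\<^sup>2 \<partial>\<nu>)))"
    proof -
      have "0 \<le> (\<integral>x. (norm x)\<^sup>2 \<partial>\<nu>)"
        by simp
      then have "C * (1 + (\<integral>x. (norm x)\<^sup>2 \<partial>\<nu>) + M4) \<le> C * ((1 + M4) * (1 + (\<integral>x. (norm x)\<^sup>2 \<partial>\<nu>)))"
        using C M4 by (intro mult_left_mono) (simp_all add: algebra_simps)
      then show ?thesis
        unfolding b_def using h by (simp add: mult.assoc)
    qed
    finally show ?thesis .
  qed
  moreover have "0 \<le> C * (1 + M4)"
    using C M4 by simp
  ultimately show ?thesis
    by blast
qed

end

section \<open>The Unadjusted Langevin Algorithm\<close>

text \<open>The count starts at one step because \<open>gauss 0\<close> is not the Dirac mass at 0,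
  so \<open>heat 0\<close> is not the identity.\<close>

lemma heat_funpow:
  fixes \<nu> :: "'a::euclidean_space measure"
  assumes h: "h > 0" and \<nu>: "sets \<nu> = sets borel"
  shows "(heat h ^^ Suc k) \<nu> = heat (real (Suc k) * h) \<nu>"
proof (induction k)
  case (Suc k)
  have "(heat h ^^ Suc (Suc k)) \<nu> = heat h (heat (real (Suc k) * h) \<nu>)"
    using Suc by simp
  also have "\<dots> = heat (real (Suc k) * h + h) \<nu>"
    using h \<nu> by (intro heat_heat) simp_all
  finally show ?case
    by (simp add: algebra_simps)
qed simp

lemma heat_funpow_P2:
  assumes "h > 0" "\<nu> \<in> P2"
  shows "(heat h ^^ k) \<nu> \<in> P2"
  using assms by (induction k) (simp_all add: heat_P2)

lemma heat_funpow_norm_square: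
  fixes \<nu> :: "'a::euclidean_space measure"
  assumes "h > 0" "\<nu> \<in> P2"
  shows "(\<integral>u. (norm u)\<^sup>2 \<partial>(heat h ^^ k) \<nu>) = (\<integral>x. (norm x)\<^sup>2 \<partial>\<nu>) + 2 * (real k * h) * real DIM('a)"
  using assms by (induction k) (simp_all add: heat_funpow_P2 integral_heat_norm_square algebra_simps)

context smooth_convex_potential
begin

lemma heat_funpow_U_le:
  assumes "h > 0" "\<nu> \<in> P2"
  shows "(\<integral>u. U u \<partial>(heat h ^^ k) \<nu>) \<le> (\<integral>x. U x \<partial>\<nu>) + L * (real k * h) * real DIM('a)"
proof (induction k)
  case (Suc k)
  have "(\<integral>u. U u \<partial>(heat h ^^ Suc k) \<nu>) \<le> (\<integral>u. U u \<partial>(heat h ^^ k) \<nu>) + L * h * real DIM('a)"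
    using assms by (simp add: integral_heat_U_le heat_funpow_P2)
  also have "\<dots> \<le> (\<integral>x. U x \<partial>\<nu>) + L * (real k * h) * real DIM('a) + L * h * real DIM('a)"
    using Suc by simp
  finally show ?case
    by (simp add: algebra_simps)
qed simp

text \<open>For each large \<open>N\<close>, \<open>N\<close> coupled Metropolis steps of length
  \<gamma>/N start from \<xi> and end in a coupling of \<open>heat \<gamma> \<nu>\<close> with the
  Gibbs measure. The left side does not depend on \<open>N\<close>, so the bounds may be passed to
  the limit.\<close>

lemma W2_heat_le:
  assumes \<gamma>: "\<gamma> > 0" and \<nu>: "\<nu> \<in> P2" and \<xi>: "\<xi> \<in> couplings \<nu> (gibbs U)"
  shows "(W2 (heat \<gamma> \<nu>) (gibbs U))\<^sup>2
    \<le> ennreal (cost \<xi> + 2 * \<gamma> * ((\<integral>x. U x \<partial>\<nu>) - (\<integral>y. U y \<partial>gibbs U)) + 2 * \<gamma>\<^sup>2 * L * real DIM('a))"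
proof -
  define d where "d = real DIM('a)"
  define M2 where "M2 = (\<integral>x. (norm x)\<^sup>2 \<partial>\<nu>)"
  define E where "E = (\<integral>x. U x \<partial>\<nu>) - (\<integral>y. U y \<partial>gibbs U)"
  obtain C where C: "C \<ge> 0" and step: "\<And>h \<nu> \<xi>. 0 < h \<Longrightarrow> h \<le> 1 \<Longrightarrow> \<nu> \<in> P2 \<Longrightarrow> \<xi> \<in> couplings \<nu> (gibbs U) \<Longrightarrow>
     cost (metropolis h \<xi>) \<le> cost \<xi> + 2 * h * ((\<integral>x. U x \<partial>\<nu>) - (\<integral>y. U y \<partial>gibbs U))
       + h * sqrt h * (C * (1 + (\<integral>x. (norm x)\<^sup>2 \<partial>\<nu>)))"
    using metropolis_cost by blast
  \<comment> \<open>A bound for the factor in the Metropolis error that is valid at all intermediate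
    times: the second moment along the heat flow never exceeds its value at time \<gamma>.\<close>
  define K where "K = C * (1 + (M2 + 2 * \<gamma> * d))"
  have bound: "(W2 (heat \<gamma> \<nu>) (gibbs U))\<^sup>2 \<le> ennreal (cost \<xi> + \<gamma> * (2 * (E + L * \<gamma> * d) + sqrt (\<gamma> / real N) * K))"
    if N: "N > 0" "\<gamma> \<le> real N" for N
  proof -
    define h where "h = \<gamma> / real N"
    have h: "0 < h" "h \<le> 1" "real N * h = \<gamma>"
      using N \<gamma> by (simp_all add: h_def)
    define \<nu>s where "\<nu>s k = (heat h ^^ k) \<nu>" for k
    define \<xi>s where "\<xi>s k = (metropolis h ^^ k) \<xi>" for k
    have \<nu>s: "\<nu>s k \<in> P2" for k
      using h \<nu> by (simp add: \<nu>s_def heat_funpow_P2)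
    have \<xi>s: "\<xi>s k \<in> couplings (\<nu>s k) (gibbs U)" for k
      using \<xi> h by (induction k) (simp_all add: \<nu>s_def \<xi>s_def metropolis_coupling)
    have "cost (\<xi>s k) \<le> cost \<xi> + real k * h * (2 * (E + L * \<gamma> * d) + sqrt h * K)" if "k \<le> N" for k
      using that
    proof (induction k)
      case (Suc k)
      have kh: "real k * h \<le> \<gamma>"
        using Suc.prems h mult_right_mono[of "real k" "real N" h] by simp
      \<comment> \<open>Every intermediate growth of the mean potential is replaced by the bound at
        the final time \<gamma>. This produces the term 2\<gamma>^2 Ld; summing the growth exactly
        would give about half of it.\<close>
      have "L * (real k * h) * d \<le> L * \<gamma> * d"
        using kh L_nonneg by (intro mult_right_mono mult_left_mono) (simp_all add: d_def)
      then have "(\<integral>x. U x \<partial>\<nu>s k) - (\<integral>y. U y \<partial>gibbs U) \<le> E + L * \<gamma> * d"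
        using heat_funpow_U_le[OF h(1) \<nu>, of k] by (simp add: E_def \<nu>s_def d_def)
      then have 1: "2 * h * ((\<integral>x. U x \<partial>\<nu>s k) - (\<integral>y. U y \<partial>gibbs U)) \<le> 2 * h * (E + L * \<gamma> * d)"
        using h by (intro mult_left_mono) simp_all
      have "2 * (real k * h) * d \<le> 2 * \<gamma> * d"
        using kh by (intro mult_right_mono mult_left_mono) (simp_all add: d_def)
      then have "(\<integral>x. (norm x)\<^sup>2 \<partial>\<nu>s k) \<le> M2 + 2 * \<gamma> * d"
        using heat_funpow_norm_square[OF h(1) \<nu>, of k] by (simp add: M2_def \<nu>s_def d_def)
      then have 2: "h * sqrt h * (C * (1 + (\<integral>x. (norm x)\<^sup>2 \<partial>\<nu>s k))) \<le> h * sqrt h * K"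
        unfolding K_def using h C by (intro mult_left_mono) simp_all
      have "cost (\<xi>s (Suc k)) \<le> cost (\<xi>s k) + 2 * h * (E + L * \<gamma> * d) + h * sqrt h * K"
        using step[OF h(1,2) \<nu>s[of k] \<xi>s[of k]] 1 2 by (simp add: \<xi>s_def)
      also have "\<dots> \<le> cost \<xi> + real k * h * (2 * (E + L * \<gamma> * d) + sqrt h * K) + 2 * h * (E + L * \<gamma> * d) + h * sqrt h * K"
        using Suc by simp
      also have "\<dots> = cost \<xi> + real (Suc k) * h * (2 * (E + L * \<gamma> * d) + sqrt h * K)"
        by (simp add: algebra_simps)
      finally show ?case .
    qed (simp add: \<xi>s_def)
    from this[of N] have "cost (\<xi>s N) \<le> cost \<xi> + \<gamma> * (2 * (E + L * \<gamma> * d) + sqrt h * K)"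
      by (simp only: h(3) order_refl)
    moreover have "\<nu>s N = heat \<gamma> \<nu>"
      using heat_funpow[OF h(1) P2D(2)[OF \<nu>], of "N - 1"] N h(3) by (simp add: \<nu>s_def)
    ultimately show ?thesis
      using W2_power2_le_cost[OF \<xi>s[of N] \<nu>s gibbs_P2] by (simp add: h_def) (metis ennreal_leI order_trans)
  qed
  have "(\<lambda>N. cost \<xi> + \<gamma> * (2 * (E + L * \<gamma> * d) + sqrt (\<gamma> / real N) * K))
      \<longlonglongrightarrow> cost \<xi> + \<gamma> * (2 * (E + L * \<gamma> * d) + sqrt 0 * K)"
    by (intro tendsto_intros tendsto_divide_0[OF tendsto_const] filterlim_real_sequentially
        filterlim_at_top_imp_at_infinity)
  then have "(\<lambda>N. ennreal (cost \<xi> + \<gamma> * (2 * (E + L * \<gamma> * d) + sqrt (\<gamma> / real N) * K)))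
      \<longlonglongrightarrow> ennreal (cost \<xi> + \<gamma> * (2 * (E + L * \<gamma> * d) + sqrt 0 * K))"
    by (rule tendsto_ennrealI)
  moreover have "\<exists>N0. \<forall>N\<ge>N0. (W2 (heat \<gamma> \<nu>) (gibbs U))\<^sup>2
      \<le> ennreal (cost \<xi> + \<gamma> * (2 * (E + L * \<gamma> * d) + sqrt (\<gamma> / real N) * K))"
  proof (intro exI allI impI bound)
    \<comment> \<open>From \<open>\<lceil>\<gamma>\<rceil>\<close> on, the step \<gamma>/N is at
      most 1, as the drift estimate demands, and \<open>N\<close> is positive because \<gamma>
      is.\<close>
    fix N assume N: "nat \<lceil>\<gamma>\<rceil> \<le> N"
    then show "\<gamma> \<le> real N"
      by linarith
    then show "0 < N"
      using \<gamma> by (cases N) simp_all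
  qed
  ultimately have "(W2 (heat \<gamma> \<nu>) (gibbs U))\<^sup>2 \<le> ennreal (cost \<xi> + \<gamma> * (2 * (E + L * \<gamma> * d) + sqrt 0 * K))"
    by (rule LIMSEQ_le_const)
  then show ?thesis
    by (simp add: E_def d_def algebra_simps power2_eq_square)
qed

section \<open>The algorithm as a gradient map followed by the heat flow\<close>

lemma ula_kernel_eq: "ula_kernel U \<gamma> x = distr (gauss \<gamma>) borel (\<lambda>z. x - \<gamma> *\<^sub>R gradient U x + z)"
proof -
  define a where "a = x - \<gamma> *\<^sub>R gradient U x"
  have "ula_kernel U \<gamma> x = density (distr lborel borel ((+) a)) (\<lambda>y. ennreal (gauss_density \<gamma> (y - a)))"
    by (simp add: ula_kernel_def gauss_density_def lborel_distr_plus a_def algebra_simps)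
  also have "\<dots> = distr (density lborel (\<lambda>z. ennreal (gauss_density \<gamma> z))) borel ((+) a)"
    by (subst density_distr) simp_all
  finally show ?thesis
    by (simp add: gauss_def a_def)
qed

lemma measurable_ula_kernel:
  assumes "\<gamma> > 0"
  shows "ula_kernel U \<gamma> \<in> borel \<rightarrow>\<^sub>M subprob_algebra borel"
proof -
  have "gauss \<gamma> \<in> space (subprob_algebra (borel :: 'a measure))"
    using prob_space_gauss[OF assms, where 'a='a]
    by (simp add: space_subprob_algebra prob_space_imp_subprob_space)
  then have "(\<lambda>x. distr (gauss \<gamma>) borel (\<lambda>z. x - \<gamma> *\<^sub>R gradient U x + z)) \<in> borel \<rightarrow>\<^sub>M subprob_algebra borel"
    by (intro measurable_distr2[where M=borel]) simp_all
  then show ?thesis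
    by (simp add: ula_kernel_eq[abs_def])
qed

definition gradient_map :: "real \<Rightarrow> 'a \<Rightarrow> 'a" where
  "gradient_map \<gamma> x = x - \<gamma> *\<^sub>R gradient U x"

lemma measurable_gradient_map [measurable]: "gradient_map \<gamma> \<in> borel_measurable borel"
  unfolding gradient_map_def by measurable

lemma bind_ula_kernel:
  assumes \<gamma>: "\<gamma> > 0" and \<mu>: "\<mu> \<in> P2"
  shows "\<mu> \<bind> ula_kernel U \<gamma> = heat \<gamma> (distr \<mu> borel (gradient_map \<gamma>))"
proof (rule measure_eqI)
  note [measurable_cong] = P2D(2)[OF \<mu>]
  interpret M: prob_space \<mu> using \<mu> by (rule P2D)
  interpret N: prob_space "gauss \<gamma> :: 'a measure"
    using \<gamma> by (rule prob_space_gauss)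
  have K: "ula_kernel U \<gamma> \<in> \<mu> \<rightarrow>\<^sub>M subprob_algebra borel"
    using measurable_ula_kernel[OF \<gamma>] by (simp cong: measurable_cong_sets)
  show s: "sets (\<mu> \<bind> ula_kernel U \<gamma>) = sets (heat \<gamma> (distr \<mu> borel (gradient_map \<gamma>)))"
    using sets_bind[of \<mu> "ula_kernel U \<gamma>" borel] M.not_empty by (simp add: ula_kernel_eq)
  fix A assume "A \<in> sets (\<mu> \<bind> ula_kernel U \<gamma>)"
  then have A [measurable]: "A \<in> sets borel"
    by (simp add: s)
  have "emeasure (\<mu> \<bind> ula_kernel U \<gamma>) A = (\<integral>\<^sup>+x. emeasure (ula_kernel U \<gamma> x) A \<partial>\<mu>)"
    using K M.not_empty A by (intro emeasure_bind)
  also have "\<dots> = (\<integral>\<^sup>+x. \<integral>\<^sup>+z. indicator A (gradient_map \<gamma> x + z) \<partial>gauss \<gamma> \<partial>\<mu>)"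
  proof (intro nn_integral_cong)
    fix x
    have "emeasure (ula_kernel U \<gamma> x) A = (\<integral>\<^sup>+y. indicator A y \<partial>ula_kernel U \<gamma> x)"
      by (simp add: ula_kernel_eq)
    also have "\<dots> = (\<integral>\<^sup>+z. indicator A (gradient_map \<gamma> x + z) \<partial>gauss \<gamma>)"
      unfolding ula_kernel_eq gradient_map_def[symmetric] by (subst nn_integral_distr) simp_all
    finally show "emeasure (ula_kernel U \<gamma> x) A = (\<integral>\<^sup>+z. indicator A (gradient_map \<gamma> x + z) \<partial>gauss \<gamma>)" .
  qed
  also have "\<dots> = (\<integral>\<^sup>+x. \<integral>\<^sup>+z. indicator A (x + z) \<partial>gauss \<gamma> \<partial>distr \<mu> borel (gradient_map \<gamma>))"
    by (subst nn_integral_distr) simp_all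
  also have "\<dots> = (\<integral>\<^sup>+u. indicator A u \<partial>heat \<gamma> (distr \<mu> borel (gradient_map \<gamma>)))"
    using \<gamma> by (subst nn_integral_heat) simp_all
  finally show "emeasure (\<mu> \<bind> ula_kernel U \<gamma>) A = emeasure (heat \<gamma> (distr \<mu> borel (gradient_map \<gamma>))) A"
    by simp
qed

lemma distr_gradient_map_P2:
  assumes \<gamma>: "\<gamma> > 0" "\<gamma> * L \<le> 1" and \<mu>: "\<mu> \<in> P2"
  shows "distr \<mu> borel (gradient_map \<gamma>) \<in> P2"
proof -
  note [measurable_cong] = P2D(2)[OF \<mu>]
  interpret M: prob_space \<mu> using \<mu> by (rule P2D)
  define g where "g = norm (gradient U 0)"
  have "norm (gradient_map \<gamma> x) \<le> 2 * norm x + \<gamma> * g" for x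
  proof -
    have "norm (gradient_map \<gamma> x) \<le> norm x + \<gamma> * norm (gradient U x)"
      using \<gamma> norm_triangle_ineq4[of x "\<gamma> *\<^sub>R gradient U x"] by (simp add: gradient_map_def)
    also have "\<gamma> * norm (gradient U x) \<le> \<gamma> * (g + L * norm x)"
      using \<gamma> gradient_growth[of x] by (intro mult_left_mono) (simp_all add: g_def)
    also have "\<gamma> * (g + L * norm x) \<le> \<gamma> * g + 1 * norm x"
      using \<gamma> mult_right_mono[of "\<gamma> * L" 1 "norm x"] by (simp add: algebra_simps)
    finally show ?thesis by simp
  qed
  then have "(norm (gradient_map \<gamma> x))\<^sup>2 \<le> (2 * norm x + \<gamma> * g)\<^sup>2" for x
    by (intro power_mono) simp_all
  also have "(2 * norm x + \<gamma> * g)\<^sup>2 \<le> 2 * (2 * norm x)\<^sup>2 + 2 * (\<gamma> * g)\<^sup>2" for x :: 'a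
    using zero_le_power2[of "2 * norm x - \<gamma> * g"] unfolding power2_diff power2_sum by linarith
  finally have b: "(norm (gradient_map \<gamma> x))\<^sup>2 \<le> 8 * (norm x)\<^sup>2 + 2 * (\<gamma> * g)\<^sup>2" for x
    by (simp add: power_mult_distrib)
  have "(\<integral>\<^sup>+x. ennreal ((norm x)\<^sup>2) \<partial>distr \<mu> borel (gradient_map \<gamma>)) = (\<integral>\<^sup>+x. ennreal ((norm (gradient_map \<gamma> x))\<^sup>2) \<partial>\<mu>)"
    by (subst nn_integral_distr) simp_all
  also have "\<dots> \<le> (\<integral>\<^sup>+x. ennreal (8 * (norm x)\<^sup>2 + 2 * (\<gamma> * g)\<^sup>2) \<partial>\<mu>)"
    by (intro nn_integral_mono ennreal_leI b)
  also have "\<dots> = ennreal (\<integral>x. 8 * (norm x)\<^sup>2 + 2 * (\<gamma> * g)\<^sup>2 \<partial>\<mu>)"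
    using P2D(4)[OF \<mu>] by (intro nn_integral_eq_integral) auto
  also have "\<dots> < \<infinity>"
    by simp
  finally show ?thesis
    by (auto simp: P2_def intro!: M.prob_space_distr)
qed

text \<open>Move only the first coordinate of the coupling by the gradient map and integrate
  \<open>gradient_step\<close>. The potential gap is kept on the left, with the factor 2\<gamma>,
  because the same expression appears in \<open>W2_heat_le\<close>.\<close>

lemma gradient_map_coupling:
  assumes \<gamma>: "\<gamma> > 0" "\<gamma> * L \<le> 1" and \<mu>: "\<mu> \<in> P2" and \<xi>: "\<xi> \<in> couplings \<mu> (gibbs U)"
  obtains \<xi>' where "\<xi>' \<in> couplings (distr \<mu> borel (gradient_map \<gamma>)) (gibbs U)"
    "cost \<xi>' + 2 * \<gamma> * ((\<integral>x. U x \<partial>distr \<mu> borel (gradient_map \<gamma>)) - (\<integral>y. U y \<partial>gibbs U)) \<le> (1 - m * \<gamma>) * cost \<xi>"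
proof -
  note [measurable_cong] = couplingsD(1)[OF \<xi>]
  note D = couplingsD[OF \<xi>]
  define \<nu> where "\<nu> = distr \<mu> borel (gradient_map \<gamma>)"
  have \<nu>: "\<nu> \<in> P2"
    unfolding \<nu>_def by (rule distr_gradient_map_P2[OF \<gamma> \<mu>])
  define \<xi>' where "\<xi>' = distr \<xi> (borel \<Otimes>\<^sub>M borel) (\<lambda>p. (gradient_map \<gamma> (fst p), snd p))"
  have "distr \<xi>' borel fst = distr \<xi> borel (\<lambda>p. gradient_map \<gamma> (fst p))"
    unfolding \<xi>'_def by (subst distr_distr) (auto intro!: distr_cong)
  also have "\<dots> = \<nu>"
    unfolding \<nu>_def D(2)[symmetric] by (subst distr_distr) (auto intro!: distr_cong)
  finally have f: "distr \<xi>' borel fst = \<nu>" .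
  have "distr \<xi>' borel snd = distr \<xi> borel snd"
    unfolding \<xi>'_def by (subst distr_distr) (auto intro!: distr_cong)
  then have \<xi>': "\<xi>' \<in> couplings \<nu> (gibbs U)"
    using f D(3) by (simp add: couplings_def \<xi>'_def)
  have int: "integrable \<xi> (\<lambda>p. (norm (gradient_map \<gamma> (fst p) - snd p))\<^sup>2)"
    "integrable \<xi> (\<lambda>p. U (gradient_map \<gamma> (fst p)))" "integrable \<xi> (\<lambda>p. U (snd p))"
    and c: "cost \<xi>' = (\<integral>p. (norm (gradient_map \<gamma> (fst p) - snd p))\<^sup>2 \<partial>\<xi>)"
    and u: "(\<integral>x. U x \<partial>\<nu>) = (\<integral>p. U (gradient_map \<gamma> (fst p)) \<partial>\<xi>)" "(\<integral>x. U x \<partial>gibbs U) = (\<integral>p. U (snd p) \<partial>\<xi>)"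
  proof -
    have "integrable \<xi>' (\<lambda>p. (norm (fst p - snd p))\<^sup>2)"
      by (rule integrable_cost[OF \<xi>' \<nu> gibbs_P2])
    then show "integrable \<xi> (\<lambda>p. (norm (gradient_map \<gamma> (fst p) - snd p))\<^sup>2)"
      unfolding \<xi>'_def by (subst (asm) integrable_distr_eq) simp_all
    show "integrable \<xi> (\<lambda>p. U (snd p))" "(\<integral>x. U x \<partial>gibbs U) = (\<integral>p. U (snd p) \<partial>\<xi>)"
      using couplings_integrable[OF \<xi> measurable_U] integrable_U[OF gibbs_P2] by simp_all
    have "integrable \<xi>' (\<lambda>p. U (fst p))" 
      using couplings_integrable[OF \<xi>' measurable_U] integrable_U[OF \<nu>] by simp
    then show "integrable \<xi> (\<lambda>p. U (gradient_map \<gamma> (fst p)))"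
      unfolding \<xi>'_def by (subst (asm) integrable_distr_eq) simp_all
    have "(\<integral>x. U x \<partial>\<nu>) = (\<integral>p. U (fst p) \<partial>\<xi>')"
      using couplings_integrable[OF \<xi>' measurable_U] by simp
    also have "\<dots> = (\<integral>p. U (gradient_map \<gamma> (fst p)) \<partial>\<xi>)"
      unfolding \<xi>'_def by (subst integral_distr) simp_all
    finally show "(\<integral>x. U x \<partial>\<nu>) = (\<integral>p. U (gradient_map \<gamma> (fst p)) \<partial>\<xi>)" .
    show "cost \<xi>' = (\<integral>p. (norm (gradient_map \<gamma> (fst p) - snd p))\<^sup>2 \<partial>\<xi>)"
      unfolding cost_def \<xi>'_def by (subst integral_distr) simp_all
  qed
  have "cost \<xi>' + 2 * \<gamma> * ((\<integral>x. U x \<partial>\<nu>) - (\<integral>y. U y \<partial>gibbs U))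
      = (\<integral>p. (norm (gradient_map \<gamma> (fst p) - snd p))\<^sup>2 + 2 * \<gamma> * (U (gradient_map \<gamma> (fst p)) - U (snd p)) \<partial>\<xi>)"
    using int by (simp add: c u)
  also have "\<dots> \<le> (\<integral>p. (1 - m * \<gamma>) * (norm (fst p - snd p))\<^sup>2 \<partial>\<xi>)"
    using int integrable_cost[OF \<xi> \<mu> gibbs_P2] gradient_step[OF \<gamma>]
    by (intro integral_mono) (simp_all add: gradient_map_def)
  also have "\<dots> = (1 - m * \<gamma>) * cost \<xi>"
    by (simp add: cost_def)
  finally show ?thesis
    using that[of \<xi>'] \<xi>' by (simp add: \<nu>_def)
qed

lemma bind_ula_kernel_P2:
  assumes \<gamma>: "\<gamma> > 0" "\<gamma> * L \<le> 1" and \<mu>: "\<mu> \<in> P2"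
  shows "\<mu> \<bind> ula_kernel U \<gamma> \<in> P2"
  using assms by (simp add: bind_ula_kernel heat_P2 distr_gradient_map_P2)

text \<open>\<open>enn2real\<close> sends infinity to 0, so the real estimates below bound the
  distance itself only in combination with finiteness.\<close>

lemma W2_gibbs_finite:
  assumes "\<mu> \<in> P2"
  shows "(W2 \<mu> (gibbs U))\<^sup>2 < \<infinity>"
  using cost_le_W2_power2[OF assms gibbs_P2, of 1] by auto

lemma contraction_factor_nonneg:
  assumes "\<gamma> > 0" "\<gamma> * L \<le> 1"
  shows "0 \<le> 1 - m * \<gamma>"
proof -
  have "m * \<gamma> \<le> L * \<gamma>"
    using assms by (intro mult_right_mono m_le_L) simp
  then show ?thesis
    using assms by (simp only: mult.commute[of \<gamma> L])
qed

text \<open>Start from a coupling optimal up to \<open>e\<close>. The right side of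
  \<open>W2_heat_le\<close> contains exactly the left side of \<open>gradient_map_coupling\<close>,
  so the mean potentials disappear. The contraction factor is at most 1, hence the slack stays below
  \<open>e\<close>.\<close>

lemma W2_ula_step:
  assumes \<gamma>: "\<gamma> > 0" "\<gamma> * L \<le> 1" and \<mu>: "\<mu> \<in> P2"
  shows "enn2real ((W2 (\<mu> \<bind> ula_kernel U \<gamma>) (gibbs U))\<^sup>2)
    \<le> (1 - m * \<gamma>) * enn2real ((W2 \<mu> (gibbs U))\<^sup>2) + 2 * \<gamma>\<^sup>2 * L * real DIM('a)"
proof (rule field_le_epsilon)
  fix e :: real
  assume e: "e > 0"
  have q: "0 \<le> 1 - m * \<gamma>" "1 - m * \<gamma> \<le> 1"
    using \<gamma> m_pos contraction_factor_nonneg by simp_all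
  obtain \<xi> where \<xi>: "\<xi> \<in> couplings \<mu> (gibbs U)" and c: "cost \<xi> \<le> enn2real ((W2 \<mu> (gibbs U))\<^sup>2) + e"
    using cost_le_W2_power2[OF \<mu> gibbs_P2 e] by blast
  obtain \<xi>' where \<xi>': "\<xi>' \<in> couplings (distr \<mu> borel (gradient_map \<gamma>)) (gibbs U)"
    and c': "cost \<xi>' + 2 * \<gamma> * ((\<integral>x. U x \<partial>distr \<mu> borel (gradient_map \<gamma>)) - (\<integral>y. U y \<partial>gibbs U)) \<le> (1 - m * \<gamma>) * cost \<xi>"
    using gradient_map_coupling[OF \<gamma> \<mu> \<xi>] .
  have "(W2 (\<mu> \<bind> ula_kernel U \<gamma>) (gibbs U))\<^sup>2 \<le> ennreal (cost \<xi>'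
      + 2 * \<gamma> * ((\<integral>x. U x \<partial>distr \<mu> borel (gradient_map \<gamma>)) - (\<integral>y. U y \<partial>gibbs U)) + 2 * \<gamma>\<^sup>2 * L * real DIM('a))"
    unfolding bind_ula_kernel[OF \<gamma>(1) \<mu>]
    by (rule W2_heat_le[OF \<gamma>(1) distr_gradient_map_P2[OF \<gamma> \<mu>] \<xi>'])
  also have "\<dots> \<le> ennreal ((1 - m * \<gamma>) * cost \<xi> + 2 * \<gamma>\<^sup>2 * L * real DIM('a))"
    using c' by (intro ennreal_leI) simp
  finally have "enn2real ((W2 (\<mu> \<bind> ula_kernel U \<gamma>) (gibbs U))\<^sup>2) \<le> (1 - m * \<gamma>) * cost \<xi> + 2 * \<gamma>\<^sup>2 * L * real DIM('a)"
    using q L_nonneg by (intro enn2real_leI) simp_all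
  also have "\<dots> \<le> (1 - m * \<gamma>) * (enn2real ((W2 \<mu> (gibbs U))\<^sup>2) + e) + 2 * \<gamma>\<^sup>2 * L * real DIM('a)"
    using c q by (intro add_right_mono mult_left_mono)
  also have "\<dots> \<le> (1 - m * \<gamma>) * enn2real ((W2 \<mu> (gibbs U))\<^sup>2) + 2 * \<gamma>\<^sup>2 * L * real DIM('a) + e"
    using q e mult_right_mono[of "1 - m * \<gamma>" 1 e] by (simp add: algebra_simps)
  finally show "enn2real ((W2 (\<mu> \<bind> ula_kernel U \<gamma>) (gibbs U))\<^sup>2)
    \<le> (1 - m * \<gamma>) * enn2real ((W2 \<mu> (gibbs U))\<^sup>2) + 2 * \<gamma>\<^sup>2 * L * real DIM('a) + e" .
qed

lemma measurable_kernel_power: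
  assumes "\<gamma> > 0"
  shows "kernel_power (ula_kernel U \<gamma>) k \<in> borel \<rightarrow>\<^sub>M subprob_algebra borel"
  using measurable_ula_kernel[OF assms]
  by (induction k) (simp_all add: return_measurable measurable_bind2)

text \<open>Associativity lets the newest step act on the measure reached so far, which is the form
  in which the one-step estimate applies.\<close>

lemma bind_kernel_power_Suc:
  assumes \<gamma>: "\<gamma> > 0" and \<mu>: "sets \<mu> = sets borel"
  shows "\<mu> \<bind> kernel_power (ula_kernel U \<gamma>) (Suc k) = (\<mu> \<bind> kernel_power (ula_kernel U \<gamma>) k) \<bind> ula_kernel U \<gamma>"
proof -
  have "kernel_power (ula_kernel U \<gamma>) k \<in> \<mu> \<rightarrow>\<^sub>M subprob_algebra borel"
    using measurable_kernel_power[OF \<gamma>] \<mu> by (simp cong: measurable_cong_sets)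
  from bind_assoc[OF this measurable_ula_kernel[OF \<gamma>]] show ?thesis
    by simp
qed

text \<open>The additive term b = 2\<gamma>Ld/m is the fixed point of a \<mapsto> (1 - m\<gamma>) a
  + 2\<gamma>^2 Ld, since m\<gamma>b = 2\<gamma>^2 Ld; the excess over b contracts geometrically.
  Membership in \<open>P2\<close> is part of the induction because the next step relies on
  it.\<close>

lemma W2_ula_iterates:
  assumes \<gamma>: "\<gamma> > 0" "\<gamma> * L \<le> 1" and \<mu>: "\<mu> \<in> P2"
  shows "\<mu> \<bind> kernel_power (ula_kernel U \<gamma>) n \<in> P2 \<and>
    enn2real ((W2 (\<mu> \<bind> kernel_power (ula_kernel U \<gamma>) n) (gibbs U))\<^sup>2)
    \<le> (1 - m * \<gamma>) ^ n * enn2real ((W2 \<mu> (gibbs U))\<^sup>2) + 2 * \<gamma> * L * real DIM('a) / m"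
proof (induction n)
  case 0
  have "\<mu> \<bind> return borel = \<mu>"
    using P2D(2)[OF \<mu>] by (rule bind_return'')
  then show ?case
    using \<mu> \<gamma> L_nonneg m_pos by simp
next
  case (Suc n)
  define b where "b = 2 * \<gamma> * L * real DIM('a) / m"
  define w where "w = enn2real ((W2 \<mu> (gibbs U))\<^sup>2)"
  let ?\<mu> = "\<mu> \<bind> kernel_power (ula_kernel U \<gamma>) n"
  have q: "0 \<le> 1 - m * \<gamma>"
    using \<gamma> by (rule contraction_factor_nonneg)
  have "enn2real ((W2 (?\<mu> \<bind> ula_kernel U \<gamma>) (gibbs U))\<^sup>2)
      \<le> (1 - m * \<gamma>) * enn2real ((W2 ?\<mu> (gibbs U))\<^sup>2) + 2 * \<gamma>\<^sup>2 * L * real DIM('a)"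
    using Suc by (intro W2_ula_step[OF \<gamma>]) simp
  also have "\<dots> \<le> (1 - m * \<gamma>) * ((1 - m * \<gamma>) ^ n * w + b) + 2 * \<gamma>\<^sup>2 * L * real DIM('a)"
    using Suc q by (intro add_right_mono mult_left_mono) (simp_all add: w_def b_def)
  also have "2 * \<gamma>\<^sup>2 * L * real DIM('a) = m * \<gamma> * b"
    using m_pos by (simp add: b_def power2_eq_square)
  also have "(1 - m * \<gamma>) * ((1 - m * \<gamma>) ^ n * w + b) + m * \<gamma> * b = (1 - m * \<gamma>) ^ Suc n * w + b"
    by (simp add: algebra_simps)
  finally show ?case
    using Suc bind_ula_kernel_P2[OF \<gamma>, of ?\<mu>]
    by (simp only: bind_kernel_power_Suc[OF \<gamma>(1) P2D(2)[OF \<mu>]] w_def b_def)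
qed

end

theorem corollary10:
  fixes U :: "'a::euclidean_space \<Rightarrow> real"
    and m L \<epsilon> \<gamma> :: real
    and \<mu>\<^sub>0 :: "'a measure"
    and n :: nat
  assumes "m > 0"
    and "strongly_convex m U"
    and "continuously_differentiable U"
    and "L-lipschitz_on UNIV (gradient U)"
    and "\<epsilon> > 0"
    and "\<mu>\<^sub>0 \<in> P2"
    and "\<gamma> > 0"
    and "\<gamma> \<le> min (m * \<epsilon> / (4 * L * real DIM('a))) (inverse L)"
    and "W2 \<mu>\<^sub>0 (gibbs U) \<noteq> 0 \<longrightarrow>
         int n \<ge> \<lceil>ln (2 * (enn2real (W2 \<mu>\<^sub>0 (gibbs U)))\<^sup>2 / \<epsilon>) * inverse \<gamma> * inverse m\<rceil>"
  shows "(W2 (\<mu>\<^sub>0 \<bind> kernel_power (ula_kernel U \<gamma>) n) (gibbs U))\<^sup>2 \<le> ennreal \<epsilon>"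
proof -
  interpret smooth_convex_potential U m L
    using assms by unfold_locales
  have L: "L > 0"
    using m_le_L m_pos by simp
  have \<gamma>L: "\<gamma> * L \<le> 1"
    using assms(8) L by (simp add: field_simps)
  define W where "W = enn2real (W2 \<mu>\<^sub>0 (gibbs U))"
  have W: "enn2real ((W2 \<mu>\<^sub>0 (gibbs U))\<^sup>2) = W\<^sup>2"
    by (simp add: W_def power2_eq_square enn2real_mult)
  \<comment> \<open>One half of \<epsilon> is reserved for the asymptotic bias, the other for the
    remainder of the initial distance. With the 4 in the step-size bound the bias fits its
    half.\<close>
  have "2 * \<gamma> * L * real DIM('a) / m \<le> \<epsilon> / 2"
    using assms(8) L m_pos by (simp add: field_simps)
  moreover have "(1 - m * \<gamma>) ^ n * W\<^sup>2 \<le> \<epsilon> / 2"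
  \<comment> \<open>The case of the convention that ln 0 is minus infinity: there is no lower bound
    on \<open>n\<close>, and the transient term vanishes for every \<open>n\<close>, including
    0.\<close>
  proof (cases "W = 0")
    case False
    then have W_pos: "W > 0"
      by (simp add: W_def order.not_eq_order_implies_strict)
    have "W2 \<mu>\<^sub>0 (gibbs U) \<noteq> 0"
      using False by (auto simp: W_def)
    then have "ln (2 * W\<^sup>2 / \<epsilon>) * inverse \<gamma> * inverse m \<le> real n"
      using assms(9) by (simp add: W_def ceiling_le_iff)
    then have "ln (2 * W\<^sup>2 / \<epsilon>) \<le> real n * (m * \<gamma>)"
      using \<open>\<gamma> > 0\<close> m_pos by (simp add: field_simps)
    then have "exp (ln (2 * W\<^sup>2 / \<epsilon>)) \<le> exp (real n * (m * \<gamma>))"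
      by simp
    then have "2 * W\<^sup>2 / \<epsilon> \<le> exp (real n * (m * \<gamma>))"
      using W_pos \<open>\<epsilon> > 0\<close> by (subst (asm) exp_ln) simp_all
    then have *: "W\<^sup>2 * exp (- (real n * (m * \<gamma>))) \<le> \<epsilon> / 2"
      using \<open>\<epsilon> > 0\<close> by (simp add: exp_minus field_simps)
    \<comment> \<open>Without a nonnegative base, 1 - m\<gamma> \<le> exp(-m\<gamma>) could not be
      raised to the power \<open>n\<close>.\<close>
    have "0 \<le> 1 - m * \<gamma>"
      using \<open>\<gamma> > 0\<close> \<gamma>L by (rule contraction_factor_nonneg)
    then have "(1 - m * \<gamma>) ^ n \<le> exp (- (m * \<gamma>)) ^ n"
      using exp_ge_add_one_self[of "- (m * \<gamma>)"] by (intro power_mono) simp_all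
    also have "\<dots> = exp (- (real n * (m * \<gamma>)))"
      by (simp flip: exp_of_nat_mult)
    finally have "(1 - m * \<gamma>) ^ n * W\<^sup>2 \<le> exp (- (real n * (m * \<gamma>))) * W\<^sup>2"
      by (intro mult_right_mono) simp_all
    then show ?thesis
      using * by (simp add: mult.commute)
  qed (use \<open>\<epsilon> > 0\<close> in simp)
  moreover note W2_ula_iterates[OF \<open>\<gamma> > 0\<close> \<gamma>L \<open>\<mu>\<^sub>0 \<in> P2\<close>, of n]
  ultimately have *: "\<mu>\<^sub>0 \<bind> kernel_power (ula_kernel U \<gamma>) n \<in> P2"
    "enn2real ((W2 (\<mu>\<^sub>0 \<bind> kernel_power (ula_kernel U \<gamma>) n) (gibbs U))\<^sup>2) \<le> \<epsilon>"
    by (simp_all add: W)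
  then show ?thesis
    using W2_gibbs_finite[OF *(1)] by (metis ennreal_enn2real ennreal_leI infinity_ennreal_def)
qed

end
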